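(* Let $k\ge2$ be an integer, let $X_1,\dots,X_n$ be an i.i.d. sample from a $k$-monotone density on $(0,\infty)$, and let $\tilde g_n$ be the least squares estimator over $\mathcal M_k\cap L_2(\lambda)$. Then there exist $m\in\mathbb N\setminus\{0\}$, points $\tilde a_1,\dots,\tilde a_m\in(0,\infty)$ and numbers $\tilde w_1,\dots,\tilde w_m$ such that for all $x>0$, $$\tilde g_n(x)=\tilde w_1\frac{k(\tilde a_1-x)_+^{k-1}}{\tilde a_1^k}+\cdots+\tilde w_m\frac{k(\tilde a_m-x)_+^{k-1}}{\tilde a_m^k}.$$
   Context: For $k\ge2$, a function $g$ on $(0,\infty)$ is $k$-monotone if $(-1)^l g^{(l)}$ is nonnegative, nonincreasing and convex for $l=0,\dots,k-2$. $\mathcal M_k$ is the class of $k$-monotone functions on $(0,\infty)$; $\lambda$ is Lebesgue measure on $(0,\infty)$. The least squares estimator $\tilde g_n$ is the minimizer over $g\in\mathcal M_k\cap L_2(\lambda)$ of $Q_n(g)=\frac12\int_0^\infty g^2(x)\,dx-\frac1n\sum_{i=1}^n g(X_i)$. Notation $y_+=\max(y,0)$. *)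

theory Defs
  imports "HOL-Probability.Probability"
begin

definition lambda_pos :: "real measure" where
  "lambda_pos = restrict_space lborel {0<..}"

text \<open>
  Elements of the class are functions on the whole line of which only the restriction to
  the open half-line matters. The condition on the derivative of order \<open>l\<close> presupposes that it
  exists, which has to be said separately because \<^const>\<open>deriv\<close> is total.
\<close>

definition k_monotone :: "nat \<Rightarrow> (real \<Rightarrow> real) set" where
  "k_monotone k = {g.
     (\<forall>l. l + 2 < k \<longrightarrow> (deriv ^^ l) g differentiable_on {0<..}) \<and>
     (\<forall>l. l + 2 \<le> k \<longrightarrow>
        (\<forall>x>0. 0 \<le> (-1) ^ l * (deriv ^^ l) g x) \<and>
        antimono_on {0<..} (\<lambda>x. (-1) ^ l * (deriv ^^ l) g x) \<and>
        convex_on {0<..} (\<lambda>x. (-1) ^ l * (deriv ^^ l) g x))}"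

definition square_integrable :: "'a measure \<Rightarrow> ('a \<Rightarrow> real) set" where
  "square_integrable M = {g \<in> borel_measurable M. integrable M (\<lambda>x. (g x)\<^sup>2)}"

definition ls_criterion :: "nat \<Rightarrow> (nat \<Rightarrow> real) \<Rightarrow> (real \<Rightarrow> real) \<Rightarrow> real" where
  "ls_criterion n x g =
     1 / 2 * (LINT t|lambda_pos. (g t)\<^sup>2) - 1 / real n * (\<Sum>i = 1..n. g (x i))"

text \<open>
  A predicate rather than a function, since a minimizer is determined only on the open half-line.
\<close>

definition is_lse :: "nat \<Rightarrow> nat \<Rightarrow> (nat \<Rightarrow> real) \<Rightarrow> (real \<Rightarrow> real) \<Rightarrow> bool" where
  "is_lse k n x g \<longleftrightarrow>
     is_arg_min (ls_criterion n x) (\<lambda>h. h \<in> k_monotone k \<inter> square_integrable lambda_pos) g"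

end

theory Submission
  imports Defs
begin

text \<open>
  Let \<open>g\<close> be a least squares estimator, write \<open>F\<^sub>l = (-1)\<^sup>l g\<^sup>(\<^sup>l\<^sup>)\<close>, and let \<open>f = F\<^bsub>k-2\<^esub>\<close>, which is
  convex. The function \<open>g\<close> is a spline as claimed exactly if \<open>f\<close> is piecewise linear with finitely
  many kinks, so it has to be shown that \<open>f\<close> has finitely many kinks.

  A kink \<open>s\<close> allows a two-sided variation. Let \<open>p < s < q\<close>, let \<open>\<psi>\<close> be a subgradient of \<open>f\<close>, and
  let \<open>u\<close> vanish beyond \<open>q\<close> and have as slope that of \<open>f\<close> clamped to \<open>[\<psi> p, \<psi> q]\<close>, minus \<open>\<psi> q\<close>.
  Then \<open>f + \<epsilon> u\<close> is nonnegative, nonincreasing and convex for all \<open>\<bar>\<epsilon>\<bar> \<le> 1\<close>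
  (\<open>add_bend_monotone\<close>). Integrating \<open>u\<close> from the right \<open>k - 2\<close> times gives \<open>h\<close> with
  \<open>g + \<epsilon> h\<close> \<open>k\<close>-monotone, and minimality of \<open>g\<close> forces \<open>\<integral> g h = (1/n) \<Sum>\<^sub>i h (X\<^sub>i)\<close>
  (\<open>first_variation\<close>). Since \<open>u\<close> lies between \<open>(\<psi> q - \<psi> p) (p - x)\<^sub>+\<close> and
  \<open>(\<psi> q - \<psi> p) (q - x)\<^sub>+\<close>, a multiple of \<open>h\<close> lies between \<open>(p - x)\<^sub>+\<^bsup>k-1\<^esup>\<close> and \<open>(q - x)\<^sub>+\<^bsup>k-1\<^esup>\<close>
  (\<open>truncated_power_sandwich\<close>); the multiple exists because \<open>\<psi> p < \<psi> q\<close> around a kink. Letting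
  \<open>p\<close> and \<open>q\<close> tend to \<open>s\<close> shows that every kink \<open>s\<close> is a zero of
  \<open>D(s) = \<integral>\<^sub>0\<^sup>s g(x) (s - x)\<^bsup>k-1\<^esup> dx - (1/n) \<Sum>\<^sub>i (s - X\<^sub>i)\<^sub>+\<^bsup>k-1\<^esup>\<close>.

  Between sample points the derivative of order \<open>k\<close> of \<open>D\<close> is \<open>(k-1)! g\<close>, so by repeated use of
  Rolle's theorem \<open>D\<close> has only finitely many zeros where \<open>g > 0\<close> (\<open>finite_moment_zeros\<close>). Where
  \<open>g = 0\<close> there is at most one kink, at the left end. Hence the kinks are finite in number.

  Then \<open>f\<close> is an affine function plus a finite combination of functions \<open>(a - x)\<^sub>+\<close>. Subtracting from \<open>g\<close>
  the same combination of \<open>(a - x)\<^sub>+\<^bsup>k-1\<^esup> / (k-1)!\<close> leaves a function whose derivative of order \<open>k - 2\<close> is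
  affine. Square integrability makes \<open>g\<close> and with it all \<open>F\<^sub>l\<close> tend to \<open>0\<close> at infinity, and the truncated
  powers vanish there; so the remainder and its derivatives tend to \<open>0\<close>, which is only possible
  if it is \<open>0\<close>.
\<close>

section \<open>Subgradients of convex functions of one variable\<close>

definition subgradient_on :: "real set \<Rightarrow> (real \<Rightarrow> real) \<Rightarrow> (real \<Rightarrow> real) \<Rightarrow> bool" where
  "subgradient_on S w s \<longleftrightarrow> (\<forall>x\<in>S. \<forall>y\<in>S. w x + s x * (y - x) \<le> w y)"

lemma subgradient_onD:
  "\<lbrakk>subgradient_on S w s; x \<in> S; y \<in> S\<rbrakk> \<Longrightarrow> w x + s x * (y - x) \<le> w y"
  by (auto simp: subgradient_on_def)

lemma subgradient_on_mono:
  assumes "subgradient_on S w s" "x \<in> S" "y \<in> S" "x \<le> y"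
  shows "s x \<le> s y"
proof (cases "x = y")
  case False
  have "w x + s x * (y - x) \<le> w y" "w y + s y * (x - y) \<le> w x"
    using assms by (auto simp: subgradient_on_def)
  then have "s x * (y - x) \<le> s y * (y - x)"
    by (simp add: algebra_simps)
  then show ?thesis
    using False assms(4) by (auto simp: mult_le_cancel_right)
qed simp

text \<open>Subgradient inequalities on two adjacent intervals combine at the common point because a
  subgradient is nondecreasing. This reduces convexity of a piecewise defined function to its
  pieces.\<close>

lemma subgradient_on_union:
  assumes S: "subgradient_on S w s" and T: "subgradient_on T w s"
    and c: "c \<in> S" "c \<in> T" "\<And>x. x \<in> S \<Longrightarrow> x \<le> c" "\<And>x. x \<in> T \<Longrightarrow> c \<le> x"
  shows "subgradient_on (S \<union> T) w s"
proof -
  have up: "w x + s x * (y - x) \<le> w y" if "x \<in> S" "y \<in> T" for x y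
  proof -
    have "s x * (y - c) \<le> s c * (y - c)"
      using subgradient_on_mono[OF S that(1) c(1)] c that by (intro mult_right_mono) auto
    moreover have "w x + s x * (c - x) \<le> w c" "w c + s c * (y - c) \<le> w y"
      using S T c that by (auto simp: subgradient_on_def)
    ultimately show ?thesis by (simp add: algebra_simps)
  qed
  have down: "w y + s y * (x - y) \<le> w x" if "x \<in> S" "y \<in> T" for x y
  proof -
    have "s c * (c - x) \<le> s y * (c - x)"
      using subgradient_on_mono[OF T c(2) that(2)] c that by (intro mult_right_mono) auto
    moreover have "w c + s c * (x - c) \<le> w x" "w y + s y * (c - y) \<le> w c"
      using S T c that by (auto simp: subgradient_on_def)
    ultimately show ?thesis by (simp add: algebra_simps)
  qed
  show ?thesis
    using S T up down unfolding subgradient_on_def by blast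
qed

lemma subgradient_on_imp_convex_on:
  assumes "subgradient_on S w s" "convex S"
  shows "convex_on S w"
proof (rule convex_onI)
  fix t x y :: real
  assume t: "0 < t" "t < 1" and xy: "x \<in> S" "y \<in> S"
  define z where "z = (1 - t) * x + t * y"
  have z: "z \<in> S"
    using convexD[OF assms(2) xy, of "1 - t" t] t by (simp add: z_def)
  have "(1 - t) * (w z + s z * (x - z)) \<le> (1 - t) * w x" "t * (w z + s z * (y - z)) \<le> t * w y"
    using subgradient_onD[OF assms(1) z] xy t by (auto intro!: mult_left_mono)
  moreover have "(1 - t) * (w z + s z * (x - z)) + t * (w z + s z * (y - z))
      = w z + s z * (((1 - t) * x + t * y) - z)"
    by (simp add: algebra_simps)
  ultimately show "w ((1 - t) *\<^sub>R x + t *\<^sub>R y) \<le> (1 - t) * w x + t * w y"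
    unfolding z_def by simp
qed (fact assms)

lemma convex_on_subgradient_exists:
  assumes "convex_on {0<..} f"
  obtains s where "subgradient_on {0<..} f s"
proof
  show "subgradient_on {0<..} f (\<lambda>x. Inf ((\<lambda>t. (f x - f t) / (x - t)) ` ({x<..} \<inter> {0<..})))"
    using convex_le_Inf_differential[OF assms] by (auto simp: subgradient_on_def interior_open)
qed

text \<open>A tangent that never rises forces monotonicity, and a lower bound far out then spreads to
  the whole half-line.\<close>

lemma subgradient_nonpos_imp_monotone:
  assumes w: "subgradient_on {0<..} w s" and s: "\<And>x. x > 0 \<Longrightarrow> s x \<le> 0"
    and q: "\<And>x. \<lbrakk>0 < x; q \<le> x\<rbrakk> \<Longrightarrow> 0 \<le> w x"
  shows "antimono_on {0<..} w" "convex_on {0<..} w" "\<And>x. x > 0 \<Longrightarrow> 0 \<le> w x"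
proof -
  have le: "w y \<le> w x" if "0 < x" "x \<le> y" for x y
  proof -
    have "w y + s y * (x - y) \<le> w x"
      using subgradient_onD[OF w] that by auto
    moreover have "0 \<le> s y * (x - y)"
      using s[of y] that by (intro mult_nonpos_nonpos) auto
    ultimately show ?thesis by simp
  qed
  then show "antimono_on {0<..} w" by (auto simp: monotone_on_def)
  show "convex_on {0<..} w" by (rule subgradient_on_imp_convex_on[OF w]) auto
  show "0 \<le> w x" if "x > 0" for x
    using le[of x "max x q"] q[of "max x q"] that by linarith
qed

text \<open>The slope of this function is \<open>\<psi>\<close> clamped to \<open>[\<psi> p, \<psi> q]\<close>, minus \<open>\<psi> q\<close>: it carries the
  curvature of \<open>f\<close> between \<open>p\<close> and \<open>q\<close> and no other, and it vanishes beyond \<open>q\<close>. It is the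
  direction in which \<open>f\<close> can be moved both ways.\<close>

definition bend :: "(real \<Rightarrow> real) \<Rightarrow> (real \<Rightarrow> real) \<Rightarrow> real \<Rightarrow> real \<Rightarrow> real \<Rightarrow> real" where
  "bend f \<psi> p q x =
     (if x \<le> p then f p + \<psi> p * (x - p) - f q - \<psi> q * (x - q)
      else if x \<le> q then f x - f q - \<psi> q * (x - q) else 0)"

context
  fixes f \<psi> :: "real \<Rightarrow> real" and p q :: real
  assumes f: "subgradient_on {0<..} f \<psi>" and pq: "0 < p" "p < q"
begin

lemma bend_bounds:
  assumes "x > 0"
  shows "(\<psi> q - \<psi> p) * max (p - x) 0 \<le> bend f \<psi> p q x"
    and "bend f \<psi> p q x \<le> (\<psi> q - \<psi> p) * max (q - x) 0"
proof -
  have m: "\<psi> p \<le> \<psi> q"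
    using subgradient_on_mono[OF f] pq by auto
  have a: "f y + \<psi> y * (z - y) \<le> f z" if "y > 0" "z > 0" for y z
    using subgradient_onD[OF f] that by auto
  show "(\<psi> q - \<psi> p) * max (p - x) 0 \<le> bend f \<psi> p q x"
    using a[of q p] a[of q x] pq assms by (auto simp: bend_def algebra_simps)
  consider "x \<le> p" | "p < x" "x \<le> q" | "q < x" by linarith
  then show "bend f \<psi> p q x \<le> (\<psi> q - \<psi> p) * max (q - x) 0"
  proof cases
    case 1
    then show ?thesis using a[of p q] pq by (auto simp: bend_def algebra_simps)
  next
    case 2
    have "0 \<le> (\<psi> x - \<psi> p) * (q - x)"
      using subgradient_on_mono[OF f, of p x] 2 pq by auto
    then show ?thesis using a[of x q] 2 pq by (auto simp: bend_def algebra_simps)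
  qed (use pq in \<open>simp add: bend_def\<close>)
qed

lemma continuous_on_bend: "continuous_on UNIV (bend f \<psi> p q)"
proof -
  have "convex_on {0<..} f"
    using f by (rule subgradient_on_imp_convex_on) auto
  then have "continuous_on {0<..} f"
    by (intro convex_on_continuous) auto
  then have fc: "continuous_on UNIV (\<lambda>x. f (max p (min x q)))"
    by (rule continuous_on_compose2) (use pq in \<open>auto intro!: continuous_intros\<close>)
  have "bend f \<psi> p q = (\<lambda>x. f (max p (min x q)) + \<psi> p * (min x q - max p (min x q))
          - f q - \<psi> q * (min x q - q))"
    using pq by (auto simp: bend_def fun_eq_iff max_def min_def)
  with fc show ?thesis by (auto intro!: continuous_intros)
qed

text \<open>Between \<open>p\<close> and \<open>q\<close> the slope of the perturbed function increases by \<open>1 + \<epsilon>\<close> times as much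
  as that of \<open>f\<close>, elsewhere by exactly as much. So convexity survives as long as \<open>\<epsilon> \<ge> - 1\<close>.\<close>

lemma subgradient_on_add_bend:
  assumes e: "\<bar>\<epsilon>\<bar> \<le> 1"
  shows "subgradient_on {0<..} (\<lambda>x. f x + \<epsilon> * bend f \<psi> p q x)
           (\<lambda>x. \<psi> x + \<epsilon> * (\<psi> (max p (min x q)) - \<psi> q))"
    (is "subgradient_on _ ?w ?s")
proof -
  have a: "f y + \<psi> y * (z - y) \<le> f z" if "y > 0" "z > 0" for y z
    using subgradient_onD[OF f] that by auto
  have 1: "subgradient_on {0<..p} ?w ?s"
    unfolding subgradient_on_def
  proof (intro ballI)
    fix x y assume xy: "x \<in> {0<..p}" "y \<in> {0<..p}"
    then show "?w x + ?s x * (y - x) \<le> ?w y"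
      using a[of x y] pq by (simp add: bend_def) (simp add: algebra_simps)
  qed
  have w2: "?w x = (1 + \<epsilon>) * f x - \<epsilon> * (f q + \<psi> q * (x - q))" if "x \<in> {p..q}" for x
    using that pq by (auto simp: bend_def algebra_simps)
  have 2: "subgradient_on {p..q} ?w ?s"
    unfolding subgradient_on_def
  proof (intro ballI)
    fix x y assume xy: "x \<in> {p..q}" "y \<in> {p..q}"
    have "(1 + \<epsilon>) * (f x + \<psi> x * (y - x)) \<le> (1 + \<epsilon>) * f y"
      using a[of x y] xy pq e by (intro mult_left_mono) auto
    then show "?w x + ?s x * (y - x) \<le> ?w y"
      unfolding w2[OF xy(1)] w2[OF xy(2)] using xy by (simp add: algebra_simps)
  qed
  have 3: "subgradient_on {q..} ?w ?s"
    unfolding subgradient_on_def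
  proof (intro ballI)
    fix x y assume xy: "x \<in> {q..}" "y \<in> {q..}"
    then have "bend f \<psi> p q x = 0" "bend f \<psi> p q y = 0" "max p (min x q) = q"
      using pq by (auto simp: bend_def)
    then show "?w x + ?s x * (y - x) \<le> ?w y"
      using a[of x y] xy pq by simp
  qed
  have "subgradient_on ({0<..p} \<union> {p..q}) ?w ?s"
    using 1 2 by (rule subgradient_on_union[where c = p]) (use pq in auto)
  then have "subgradient_on ({0<..p} \<union> {p..q} \<union> {q..}) ?w ?s"
    using 3 by (rule subgradient_on_union[where c = q]) (use pq in auto)
  moreover have "{0<..p} \<union> {p..q} \<union> {q..} = {0<..}"
    using pq by auto
  ultimately show ?thesis by simp
qed

text \<open>For \<open>\<epsilon> < 0\<close> the perturbation makes the slope larger, but since \<open>\<bar>\<epsilon>\<bar> \<le> 1\<close> by at most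
  \<open>\<psi> q - \<psi> m\<close> with \<open>m\<close> the point of \<open>[p, q]\<close> nearest to \<open>x\<close>, which leaves it below \<open>\<psi> q \<le> 0\<close> for
  \<open>x \<le> q\<close>; beyond \<open>q\<close> nothing changes.\<close>

lemma add_bend_monotone:
  assumes e: "\<bar>\<epsilon>\<bar> \<le> 1" and nonneg: "\<And>x. x > 0 \<Longrightarrow> 0 \<le> f x" and anti: "antimono_on {0<..} f"
  defines "w \<equiv> \<lambda>x. f x + \<epsilon> * bend f \<psi> p q x"
  shows "antimono_on {0<..} w" "convex_on {0<..} w" "\<And>x. x > 0 \<Longrightarrow> 0 \<le> w x"
proof -
  have \<psi>: "\<psi> x \<le> 0" if "x > 0" for x
  proof -
    have "f x + \<psi> x * ((x + 1) - x) \<le> f (x + 1)"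
      by (rule subgradient_onD[OF f]) (use that in auto)
    moreover have "f (x + 1) \<le> f x"
      using anti that by (auto simp: monotone_on_def)
    ultimately show ?thesis by simp
  qed
  have s: "\<psi> x + \<epsilon> * (\<psi> (max p (min x q)) - \<psi> q) \<le> 0" if "x > 0" for x
  proof -
    define m where "m = max p (min x q)"
    have m: "p \<le> m" "m \<le> q" using pq by (auto simp: m_def)
    have mq: "\<psi> m \<le> \<psi> q" using subgradient_on_mono[OF f] m pq by auto
    have "\<epsilon> * (\<psi> m - \<psi> q) \<le> \<psi> q - \<psi> m"
      using mult_right_mono[of "-\<epsilon>" 1 "\<psi> q - \<psi> m"] mq e by (simp add: algebra_simps)
    moreover have "\<psi> x \<le> \<psi> m" if "x \<le> q"
      using subgradient_on_mono[OF f, of x m] that \<open>x > 0\<close> m pq by (auto simp: m_def)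
    moreover have "m = q" if "q < x" using that pq by (auto simp: m_def)
    ultimately show ?thesis
      using \<psi>[of q] \<psi>[of x] pq that unfolding m_def[symmetric] by (cases "x \<le> q") auto
  qed
  have q: "0 \<le> w x" if "0 < x" "q \<le> x" for x
    using that nonneg[of x] pq by (auto simp: w_def bend_def)
  from subgradient_nonpos_imp_monotone[OF subgradient_on_add_bend[OF e] s q[unfolded w_def]]
  show "antimono_on {0<..} w" "convex_on {0<..} w" "\<And>x. x > 0 \<Longrightarrow> 0 \<le> w x"
    unfolding w_def by auto
qed

end

section \<open>Chains of signed derivatives\<close>

text \<open>For a \<open>k\<close>-monotone function the signed derivatives \<open>(-1)\<^sup>l g\<^sup>(\<^sup>l\<^sup>)\<close> form a chain of this kind
  of length \<open>k - 2\<close>. Putting the sign into the members makes every step of the chain alike: each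
  function is, up to a constant, the integral of the next one from the right.\<close>

definition descending_chain :: "nat \<Rightarrow> (nat \<Rightarrow> real \<Rightarrow> real) \<Rightarrow> bool" where
  "descending_chain N F \<longleftrightarrow>
     (\<forall>l<N. \<forall>x>0. (F l has_real_derivative - F (Suc l) x) (at x))"

lemma descending_chainD:
  "\<lbrakk>descending_chain N F; l < N; x > 0\<rbrakk> \<Longrightarrow> (F l has_real_derivative - F (Suc l) x) (at x)"
  by (auto simp: descending_chain_def)

lemma descending_chain_add:
  assumes "descending_chain N F" "descending_chain N G"
  shows "descending_chain N (\<lambda>l x. F l x + c * G l x)"
  using assms by (auto simp: descending_chain_def intro!: derivative_eq_intros)

lemma descending_chain_sum:
  assumes "\<And>a. a \<in> A \<Longrightarrow> descending_chain N (G a)"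
  shows "descending_chain N (\<lambda>l x. \<Sum>a\<in>A. c a * G a l x)"
  using assms
  by (auto simp: descending_chain_def sum_negf[symmetric] intro!: derivative_eq_intros sum.cong)

lemma truncated_power_has_derivative:
  "((\<lambda>x::real. max (a - x) 0 ^ Suc (Suc j)) has_real_derivative
      - (real (Suc (Suc j)) * max (a - x) 0 ^ Suc j)) (at x)"
proof (rule linorder_cases[of x a])
  assume "x < a"
  then have "((\<lambda>x. (a - x) ^ Suc (Suc j)) has_real_derivative
      - (real (Suc (Suc j)) * max (a - x) 0 ^ Suc j)) (at x)"
    by (auto intro!: derivative_eq_intros simp del: power_Suc)
  then show ?thesis
    by (rule has_field_derivative_transform_within_open[where S = "{..<a}"]) (use \<open>x < a\<close> in auto)
next
  assume "a < x"
  then have "((\<lambda>x. 0) has_real_derivative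
      - (real (Suc (Suc j)) * max (a - x) 0 ^ Suc j)) (at x)"
    by simp
  then show ?thesis
    by (rule has_field_derivative_transform_within_open[where S = "{a<..}"]) (use \<open>a < x\<close> in auto)
next
  assume x: "x = a"
  have "((\<lambda>y. max (a - y) 0 ^ Suc (Suc j) / (y - a)) \<longlongrightarrow> 0) (at a)"
  proof (rule Lim_null_comparison)
    have "norm (max (a - y) 0 ^ Suc (Suc j) / (y - a)) \<le> max (a - y) 0 ^ Suc j" for y
      by (cases "y < a") (auto simp: max_def divide_simps abs_mult)
    then show "\<forall>\<^sub>F y in at a. norm (max (a - y) 0 ^ Suc (Suc j) / (y - a)) \<le> max (a - y) 0 ^ Suc j"
      by (intro always_eventually) blast
    have "isCont (\<lambda>y. max (a - y) 0 ^ Suc j) a"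
      by (intro continuous_intros)
    then show "((\<lambda>y. max (a - y) 0 ^ Suc j) \<longlongrightarrow> 0) (at a)"
      by (simp add: isCont_def)
  qed
  then show ?thesis
    by (simp add: has_field_derivative_iff x)
qed

lemma descending_chain_truncated_power:
  "descending_chain N (\<lambda>l x. max (a - x) 0 ^ (Suc N - l) / fact (Suc N - l))"
  unfolding descending_chain_def
proof (intro allI impI)
  fix l x assume "l < N"
  then obtain j where j: "N - l = Suc j" "Suc N - l = Suc (Suc j)"
    by (metis Suc_diff_Suc Suc_diff_le less_imp_le)
  have "((\<lambda>x. max (a - x) 0 ^ Suc (Suc j) / fact (Suc (Suc j))) has_real_derivative
      - (real (Suc (Suc j)) * max (a - x) 0 ^ Suc j) / fact (Suc (Suc j))) (at x)"
    by (rule DERIV_cdivide[OF truncated_power_has_derivative])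
  moreover have "- (real (Suc (Suc j)) * max (a - x) 0 ^ Suc j) / fact (Suc (Suc j))
      = - (max (a - x) 0 ^ Suc j / fact (Suc j))"
    by (simp add: divide_simps del: power_Suc)
  ultimately show "((\<lambda>x. max (a - x) 0 ^ (Suc N - l) / fact (Suc N - l)) has_real_derivative
            - (max (a - x) 0 ^ (Suc N - Suc l) / fact (Suc N - Suc l))) (at x)"
    unfolding diff_Suc_Suc j by simp
qed

lemma k_monotone_imp_descending_chain:
  assumes "g \<in> k_monotone k"
  shows "descending_chain (k - 2) (\<lambda>l x. (-1) ^ l * (deriv ^^ l) g x)"
  unfolding descending_chain_def
proof (intro allI impI)
  fix l and x :: real assume l: "l < k - 2" and x: "0 < x"
  have "(deriv ^^ l) g differentiable_on {0<..}"
    using assms l by (auto simp: k_monotone_def)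
  then have "(deriv ^^ l) g differentiable at x"
    using x differentiable_on_eq_differentiable_at[OF open_greaterThan, of _ 0] by blast
  then have "((deriv ^^ l) g has_real_derivative (deriv ^^ Suc l) g x) (at x)"
    by (simp add: DERIV_deriv_iff_real_differentiable)
  then show "((\<lambda>x. (-1) ^ l * (deriv ^^ l) g x) has_real_derivative
      - ((-1) ^ Suc l * (deriv ^^ Suc l) g x)) (at x)"
    by (auto intro!: derivative_eq_intros)
qed

lemma descending_chain_antimono:
  assumes F: "descending_chain N F" "l < N" and nonneg: "\<And>x. x > 0 \<Longrightarrow> 0 \<le> F (Suc l) x"
  shows "antimono_on {0<..} (F l)"
proof -
  have "F l y \<le> F l x" if "0 < x" "x \<le> y" for x y
  proof (rule DERIV_nonpos_imp_nonincreasing[OF that(2)])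
    fix z assume "x \<le> z"
    then have "(F l has_real_derivative - F (Suc l) z) (at z)" "- F (Suc l) z \<le> 0"
      using descending_chainD[OF F, of z] nonneg[of z] that by auto
    then show "\<exists>y. (F l has_real_derivative y) (at z) \<and> y \<le> 0" by blast
  qed
  then show ?thesis by (auto simp: monotone_on_def)
qed

text \<open>Nonnegativity travels down the chain because each function is nonincreasing as soon as its
  successor is nonnegative.\<close>

lemma descending_chain_nonneg:
  assumes F: "descending_chain N F" and top: "\<And>x. x > 0 \<Longrightarrow> 0 \<le> F N x"
    and q: "\<And>l x. \<lbrakk>l \<le> N; 0 < x; q \<le> x\<rbrakk> \<Longrightarrow> 0 \<le> F l x"
    and "l \<le> N" "x > 0"
  shows "0 \<le> F l x"
  using assms(4,5)
proof (induction l arbitrary: x rule: inc_induct)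
  case base
  then show ?case by (rule top)
next
  case (step l)
  have "F l (max x q) \<le> F l x"
    using descending_chain_antimono[OF F] step by (auto simp: monotone_on_def)
  moreover have "0 \<le> F l (max x q)"
    using q[of l "max x q"] step by auto
  ultimately show ?case by linarith
qed

lemma convex_on_eq_on:
  assumes f: "convex_on S f" and eq: "\<And>x. x \<in> S \<Longrightarrow> g x = f x"
  shows "convex_on S g"
proof (rule convex_onI)
  show S: "convex S" using f by (rule convex_on_imp_convex)
  fix t x y assume t: "0 < (t::real)" "t < 1" and xy: "x \<in> S" "y \<in> S"
  then have "(1 - t) *\<^sub>R x + t *\<^sub>R y \<in> S"
    using convexD[OF S, of x y "1 - t" t] by simp
  then show "g ((1 - t) *\<^sub>R x + t *\<^sub>R y) \<le> (1 - t) * g x + t * g y"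
    using convex_onD[OF f, of t x y] t xy by (simp add: eq)
qed

text \<open>Only the top function has to be examined for shape: nonnegativity of a function makes its
  predecessor nonincreasing, and monotonicity of a function makes its predecessor convex.\<close>

lemma descending_chain_imp_k_monotone:
  assumes F: "descending_chain N F"
    and top: "\<And>x. x > 0 \<Longrightarrow> 0 \<le> F N x" "antimono_on {0<..} (F N)" "convex_on {0<..} (F N)"
    and q: "\<And>l x. \<lbrakk>l \<le> N; 0 < x; q \<le> x\<rbrakk> \<Longrightarrow> 0 \<le> F l x"
  shows "F 0 \<in> k_monotone (N + 2)"
proof -
  have nonneg: "0 \<le> F l x" if "l \<le> N" "x > 0" for l x
    by (rule descending_chain_nonneg[OF F top(1) q]) (use that in auto)
  have anti: "antimono_on {0<..} (F l)" if "l \<le> N" for l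
    using that top(2) descending_chain_antimono[OF F, of l] nonneg[of "Suc l"]
    by (cases "l = N") auto
  have conv: "convex_on {0<..} (F l)" if "l \<le> N" for l
  proof (cases "l = N")
    case False
    show ?thesis
    proof (rule convex_on_realI)
      show "(F l has_real_derivative - F (Suc l) x) (at x)" if "x \<in> {0<..}" for x
        using descending_chainD[OF F] that False \<open>l \<le> N\<close> by auto
      show "- F (Suc l) x \<le> - F (Suc l) y" if "x \<in> {0<..}" "y \<in> {0<..}" "x \<le> y" for x y
        using anti[of "Suc l"] that False \<open>l \<le> N\<close> by (auto simp: monotone_on_def)
    qed auto
  qed (use top in auto)
  have deriv: "(deriv ^^ l) (F 0) x = (-1) ^ l * F l x" if "l \<le> N" "x > 0" for l x
    using that
  proof (induction l arbitrary: x)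
    case (Suc l)
    have "((\<lambda>x. (-1) ^ l * F l x) has_real_derivative (-1) ^ Suc l * F (Suc l) x) (at x)"
      using descending_chainD[OF F, of l x] Suc.prems by (auto intro!: derivative_eq_intros)
    then have "((deriv ^^ l) (F 0) has_real_derivative (-1) ^ Suc l * F (Suc l) x) (at x)"
      by (rule has_field_derivative_transform_within_open[where S = "{0<..}"]) (use Suc in auto)
    then show ?case by (simp add: DERIV_imp_deriv)
  qed simp
  have sgn: "(-1) ^ l * (deriv ^^ l) (F 0) x = F l x" if "l \<le> N" "x > 0" for l x
    using deriv[OF that] by (simp flip: power_mult_distrib mult.assoc)
  have diff: "(deriv ^^ l) (F 0) differentiable_on {0<..}" if "l < N" for l
  proof -
    have "(deriv ^^ l) (F 0) differentiable at x" if "x > 0" for x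
    proof -
      have "((\<lambda>x. (-1) ^ l * F l x) has_real_derivative (-1) ^ l * - F (Suc l) x) (at x)"
        using descending_chainD[OF F \<open>l < N\<close> that] by (rule DERIV_cmult)
      then have "((deriv ^^ l) (F 0) has_real_derivative (-1) ^ l * - F (Suc l) x) (at x)"
        by (rule has_field_derivative_transform_within_open[where S = "{0<..}"])
           (use that deriv \<open>l < N\<close> in auto)
      then show ?thesis by (auto simp: real_differentiable_def)
    qed
    then show ?thesis by (auto simp: differentiable_on_def intro: differentiable_at_withinI)
  qed
  show ?thesis
    unfolding k_monotone_def
  proof (intro CollectI conjI allI impI)
    fix l assume "l + 2 \<le> N + 2"
    then have l: "l \<le> N" by simp
    show "0 \<le> (-1) ^ l * (deriv ^^ l) (F 0) x" if "x > 0" for x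
      using nonneg sgn l that by simp
    show "antimono_on {0<..} (\<lambda>x. (-1) ^ l * (deriv ^^ l) (F 0) x)"
      using anti[OF l] sgn[OF l] by (auto simp: monotone_on_def)
    show "convex_on {0<..} (\<lambda>x. (-1) ^ l * (deriv ^^ l) (F 0) x)"
      by (rule convex_on_eq_on[OF conv[OF l]]) (use sgn[OF l] in auto)
  qed (use diff in auto)
qed

text \<open>For \<open>0 \<le> x \<le> q\<close> this is \<open>\<integral>\<^sub>x\<^sup>q v\<close>. As a difference it is defined for \<open>x > q\<close> too, so that the
  derivative at \<open>q\<close> needs no case distinction.\<close>

definition tail_integral :: "real \<Rightarrow> (real \<Rightarrow> real) \<Rightarrow> real \<Rightarrow> real" where
  "tail_integral q v x = integral {0..q} v - integral {0..x} v"

lemma tail_integral: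
  assumes v: "continuous_on {0..} v" and q: "0 < q" "\<And>x. q \<le> x \<Longrightarrow> v x = 0"
  shows "continuous_on {0..} (tail_integral q v)"
    and "\<And>x. x > 0 \<Longrightarrow> (tail_integral q v has_real_derivative - v x) (at x)"
    and "\<And>x. q \<le> x \<Longrightarrow> tail_integral q v x = 0"
proof -
  have vc: "continuous_on {0..b} v" for b
    using v by (rule continuous_on_subset) auto
  have within: "((\<lambda>x. integral {0..x} v) has_real_derivative v x) (at x within {0..b})"
    if "x \<in> {0..b}" for x b
    using vc that by (rule integral_has_real_derivative)
  show "(tail_integral q v has_real_derivative - v x) (at x)" if "x > 0" for x
  proof -
    have "((\<lambda>x. integral {0..x} v) has_real_derivative v x) (at x)"
      using within[of x "x + 1"] that at_within_Icc_at[of 0 x "x + 1"] by auto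
    then show ?thesis
      unfolding tail_integral_def by (auto intro!: derivative_eq_intros)
  qed
  have "continuous (at x within {0..}) (\<lambda>x. integral {0..x} v)" if "x \<ge> 0" for x
  proof -
    have "continuous (at x within {0..x + 1}) (\<lambda>x. integral {0..x} v)"
      using within[of x "x + 1"] that DERIV_continuous by fastforce
    moreover have "at x within {0..x + 1} = at x within {0..}"
      by (rule at_within_nhd[of _ "{..<x+1}"]) auto
    ultimately show ?thesis by simp
  qed
  then show "continuous_on {0..} (tail_integral q v)"
    unfolding tail_integral_def
    by (intro continuous_intros) (auto simp: continuous_on_eq_continuous_within)
  show "tail_integral q v x = 0" if "q \<le> x" for x
  proof -
    have "integral {0..q} v + integral {q..x} v = integral {0..x} v"
      by (rule Henstock_Kurzweil_Integration.integral_combine)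
         (use q that in \<open>auto intro!: integrable_continuous_real vc\<close>)
    moreover have "integral {q..x} v = integral {q..x} (\<lambda>_. 0)"
      by (rule integral_cong) (use q in auto)
    ultimately show ?thesis by (simp add: tail_integral_def)
  qed
qed

lemma descending_chain_exists:
  assumes u: "continuous_on {0..} u" and q: "0 < q" "\<And>x. q \<le> x \<Longrightarrow> u x = 0"
  obtains H where "descending_chain N H" "H N = u"
    "\<And>l. continuous_on {0..} (H l)" "\<And>l x. q \<le> x \<Longrightarrow> H l x = 0"
proof
  let ?H = "\<lambda>l. (tail_integral q ^^ (N - l)) u"
  have *: "continuous_on {0..} ((tail_integral q ^^ j) u)
      \<and> (\<forall>x\<ge>q. (tail_integral q ^^ j) u x = 0)" for j
  proof (induction j)
    case (Suc j)
    then show ?case using tail_integral[of "(tail_integral q ^^ j) u" q] q by auto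
  qed (use u q in auto)
  then show "continuous_on {0..} (?H l)" "q \<le> x \<Longrightarrow> ?H l x = 0" for l x
    by auto
  show "descending_chain N ?H"
    unfolding descending_chain_def
  proof (intro allI impI)
    fix l and x :: real assume "l < N" "0 < x"
    then have "N - l = Suc (N - Suc l)" by simp
    then have "?H l = tail_integral q (?H (Suc l))" by simp
    then show "(?H l has_real_derivative - ?H (Suc l) x) (at x)"
      using tail_integral(2)[of "?H (Suc l)" q x] *[of "N - Suc l"] q(1) \<open>0 < x\<close> by presburger
  qed
qed simp

text \<open>The mean value theorem bounds each function of the chain by its predecessor one unit to the
  left, so the decay of the first function is inherited by all.\<close>

lemma descending_chain_tendsto_0:
  assumes F: "descending_chain N F" and nonneg: "\<And>l x. \<lbrakk>l \<le> N; x > 0\<rbrakk> \<Longrightarrow> 0 \<le> F l x"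
    and anti: "\<And>l. l \<le> N \<Longrightarrow> antimono_on {0<..} (F l)"
    and lim: "(F 0 \<longlongrightarrow> 0) at_top" and "l \<le> N"
  shows "(F l \<longlongrightarrow> 0) at_top"
  using \<open>l \<le> N\<close>
proof (induction l)
  case (Suc l)
  have bound: "F (Suc l) x \<le> F l (x - 1)" if "x > 1" for x
  proof -
    have "\<exists>z. x - 1 < z \<and> z < x \<and> F l x - F l (x - 1) = (x - (x - 1)) * - F (Suc l) z"
      by (rule MVT2) (use that Suc.prems in \<open>auto intro!: descending_chainD[OF F]\<close>)
    then obtain z where z: "x - 1 < z" "z < x" "F l x - F l (x - 1) = - F (Suc l) z"
      by auto
    have "F (Suc l) x \<le> F (Suc l) z"
      using anti[OF Suc.prems] z that by (auto simp: monotone_on_def)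
    also have "\<dots> \<le> F l (x - 1)"
      using z nonneg[of l x] that Suc.prems by auto
    finally show ?thesis .
  qed
  have "filterlim (\<lambda>x::real. x - 1) at_top at_top"
    using filterlim_tendsto_add_at_top[OF tendsto_const[of "-1"] filterlim_ident] by simp
  moreover have "(F l \<longlongrightarrow> 0) at_top"
    using Suc by simp
  ultimately have l: "((\<lambda>x. F l (x - 1)) \<longlongrightarrow> 0) at_top"
    by (rule filterlim_compose[rotated])
  show ?case
  proof (rule Lim_null_comparison[OF _ l])
    show "\<forall>\<^sub>F x in at_top. norm (F (Suc l) x) \<le> F l (x - 1)"
      using eventually_gt_at_top[of 1]
      by eventually_elim (use bound nonneg[OF Suc.prems] in auto)
  qed
qed (use lim in auto)

lemma descending_chain_eq_0:
  assumes F: "descending_chain N F" and top: "\<And>x. x > 0 \<Longrightarrow> F N x = 0"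
    and lim: "\<And>l. l \<le> N \<Longrightarrow> (F l \<longlongrightarrow> 0) at_top" and "l \<le> N" "x > 0"
  shows "F l x = 0"
  using assms(4,5)
proof (induction l arbitrary: x rule: inc_induct)
  case (step l)
  have "(F l has_real_derivative 0) (at x within {0<..})" if "x \<in> {0<..}" for x
    using descending_chainD[OF F, of l x] step that by (auto intro: has_field_derivative_at_within)
  then obtain c where c: "\<And>x. x > 0 \<Longrightarrow> F l x = c"
    using has_field_derivative_zero_constant[of "{0<..}" "F l"] by auto
  have "(F l \<longlongrightarrow> c) at_top"
    by (intro tendsto_eventually eventually_mono[OF eventually_gt_at_top[of 0]]) (rule c)
  moreover have "(F l \<longlongrightarrow> 0) at_top"
    using lim[of l] step by simp
  ultimately have "c = 0"
    by (rule tendsto_unique[OF trivial_limit_at_top_linorder])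
  then show ?case using c step by auto
qed (use top in auto)

section \<open>The first variation of the least squares criterion\<close>

lemma space_lambda_pos [simp]: "space lambda_pos = {0<..}"
  by (simp add: lambda_pos_def space_restrict_space)

lemma borel_measurable_lambda_pos:
  fixes h :: "real \<Rightarrow> real"
  assumes "continuous_on {0<..} h"
  shows "h \<in> borel_measurable lambda_pos"
proof -
  have "h \<in> borel_measurable (restrict_space borel {0<..})"
    using assms by (rule borel_measurable_continuous_on_restrict)
  then show ?thesis
    by (simp add: lambda_pos_def cong: measurable_cong_sets sets_restrict_space_cong)
qed

lemma integrable_lambda_pos_iff:
  fixes f :: "real \<Rightarrow> real"
  shows "integrable lambda_pos f \<longleftrightarrow> integrable lborel (\<lambda>x. indicator {0<..} x * f x)"
  by (simp add: lambda_pos_def integrable_restrict_space)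

lemma lebesgue_integral_lambda_pos:
  fixes f :: "real \<Rightarrow> real"
  shows "(LINT x|lambda_pos. f x) = (LINT x|lborel. indicator {0<..} x * f x)"
  by (simp add: lambda_pos_def integral_restrict_space)

lemma square_integrable_bounded_support:
  assumes m: "h \<in> borel_measurable lambda_pos"
    and B: "\<And>x. \<lbrakk>0 < x; x \<le> q\<rbrakk> \<Longrightarrow> \<bar>h x\<bar> \<le> B" and q: "\<And>x. q < x \<Longrightarrow> h x = 0"
  shows "h \<in> square_integrable lambda_pos"
proof -
  have "integrable lborel (\<lambda>x. indicator {0<..} x * (B\<^sup>2 * indicator {0..q} x :: real))"
  proof (rule Bochner_Integration.integrable_bound)
    show "integrable lborel (\<lambda>x. B\<^sup>2 * indicator {0..q} x :: real)"
      by (intro integrable_mult_right integrable_real_indicator) (auto simp: emeasure_lborel_Icc_eq)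
  qed (auto simp: indicator_def)
  then have "integrable lambda_pos (\<lambda>x. B\<^sup>2 * indicator {0..q} x)"
    unfolding integrable_lambda_pos_iff .
  then have "integrable lambda_pos (\<lambda>x. (h x)\<^sup>2)"
  proof (rule Bochner_Integration.integrable_bound)
    show "AE x in lambda_pos. norm ((h x)\<^sup>2) \<le> norm (B\<^sup>2 * indicator {0..q} x)"
    proof (rule AE_I2)
      fix x assume "x \<in> space lambda_pos"
      then show "norm ((h x)\<^sup>2) \<le> norm (B\<^sup>2 * indicator {0..q} x)"
        using B[of x] q[of x] power_mono[of "\<bar>h x\<bar>" B 2] by (cases "x \<le> q") auto
    qed
  qed (use m in measurable)
  with m show ?thesis by (simp add: square_integrable_def)
qed

lemma square_integrable_continuous_bounded_support:
  assumes h: "continuous_on {0..} h" and q: "\<And>x. q < x \<Longrightarrow> h x = 0"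
  shows "h \<in> square_integrable lambda_pos"
proof -
  have "compact (h ` {0..q})"
    using h by (intro compact_continuous_image) (auto intro: continuous_on_subset)
  then obtain B where "\<And>x. x \<in> {0..q} \<Longrightarrow> \<bar>h x\<bar> \<le> B"
    using compact_imp_bounded bounded_real by (metis imageI)
  moreover have "continuous_on {0<..} h"
    using h by (rule continuous_on_subset) auto
  ultimately show ?thesis
    by (intro square_integrable_bounded_support[OF borel_measurable_lambda_pos _ q, where B = B]) auto
qed

lemma square_integrable_mult:
  assumes "f \<in> square_integrable M" "h \<in> square_integrable M"
  shows "integrable M (\<lambda>x. f x * h x)"
proof (rule Bochner_Integration.integrable_bound)
  show "integrable M (\<lambda>x. (f x)\<^sup>2 + (h x)\<^sup>2)"
    using assms by (auto simp: square_integrable_def)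
  show "(\<lambda>x. f x * h x) \<in> borel_measurable M"
    using assms by (auto simp: square_integrable_def)
  have "\<bar>a * b\<bar> \<le> a\<^sup>2 + b\<^sup>2" for a b :: real
  proof -
    have "2 * (\<bar>a\<bar> * \<bar>b\<bar>) \<le> \<bar>a\<bar>\<^sup>2 + \<bar>b\<bar>\<^sup>2"
      using sum_squares_bound[of "\<bar>a\<bar>" "\<bar>b\<bar>"] by simp
    moreover have "0 \<le> \<bar>a\<bar> * \<bar>b\<bar>" by simp
    ultimately show ?thesis unfolding abs_mult power2_abs by linarith
  qed
  then show "AE x in M. norm (f x * h x) \<le> norm ((f x)\<^sup>2 + (h x)\<^sup>2)"
    by auto
qed

text \<open>Along the line \<open>g + \<epsilon> h\<close> the criterion is a quadratic polynomial in \<open>\<epsilon>\<close> with a local minimum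
  at \<open>0\<close>; the identity says that its linear coefficient is zero.\<close>

lemma first_variation:
  assumes lse: "is_lse k n x g" and h: "h \<in> square_integrable lambda_pos"
    and adm: "\<And>\<epsilon>. \<bar>\<epsilon>\<bar> \<le> 1 \<Longrightarrow> (\<lambda>t. g t + \<epsilon> * h t) \<in> k_monotone k"
  shows "(LINT t|lambda_pos. g t * h t) = 1 / real n * (\<Sum>i = 1..n. h (x i))"
proof -
  define P where "P = (LINT t|lambda_pos. g t * h t) - 1 / real n * (\<Sum>i = 1..n. h (x i))"
  define C where "C = (LINT t|lambda_pos. (h t)\<^sup>2)"
  have g: "g \<in> square_integrable lambda_pos"
    and least: "\<And>y. y \<in> k_monotone k \<inter> square_integrable lambda_pos
      \<Longrightarrow> ls_criterion n x g \<le> ls_criterion n x y"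
    using lse by (auto simp: is_lse_def is_arg_min_def not_less)
  note int = square_integrable_mult[OF g h]
  have int2: "integrable lambda_pos (\<lambda>t. (g t)\<^sup>2)" "integrable lambda_pos (\<lambda>t. (h t)\<^sup>2)"
    using g h by (auto simp: square_integrable_def)
  have expand: "(g t + \<epsilon> * h t)\<^sup>2 = (g t)\<^sup>2 + 2 * \<epsilon> * (g t * h t) + \<epsilon>\<^sup>2 * (h t)\<^sup>2" for t \<epsilon>
    by (simp add: power2_eq_square algebra_simps)
  have "0 \<le> \<epsilon> * P + \<epsilon>\<^sup>2 / 2 * C" if e: "\<bar>\<epsilon>\<bar> \<le> 1" for \<epsilon>
  proof -
    have "(\<lambda>t. g t + \<epsilon> * h t) \<in> square_integrable lambda_pos"
      using g h int int2 by (auto simp: square_integrable_def expand)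
    then have "ls_criterion n x g \<le> ls_criterion n x (\<lambda>t. g t + \<epsilon> * h t)"
      using adm[OF e] least by blast
    also have "\<dots> = ls_criterion n x g + (\<epsilon> * P + \<epsilon>\<^sup>2 / 2 * C)"
    proof -
      have "(LINT t|lambda_pos. (g t + \<epsilon> * h t)\<^sup>2)
          = (LINT t|lambda_pos. (g t)\<^sup>2) + 2 * \<epsilon> * (LINT t|lambda_pos. g t * h t) + \<epsilon>\<^sup>2 * C"
        unfolding expand C_def using int int2 by simp
      moreover have "(\<Sum>i = 1..n. g (x i) + \<epsilon> * h (x i))
          = (\<Sum>i = 1..n. g (x i)) + \<epsilon> * (\<Sum>i = 1..n. h (x i))"
        by (simp add: sum.distrib sum_distrib_left)
      ultimately show ?thesis
        unfolding ls_criterion_def P_def by (simp add: algebra_simps add_divide_distrib)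
    qed
    finally show ?thesis by simp
  qed
  moreover have "((\<lambda>\<epsilon>. \<epsilon> * P + \<epsilon>\<^sup>2 / 2 * C) has_real_derivative P) (at 0)"
    by (auto intro!: derivative_eq_intros)
  ultimately have "P = 0"
    by (intro DERIV_local_min[where d = 1]) auto
  then show ?thesis by (simp add: P_def)
qed

text \<open>If the slope of the top function changes between \<open>p\<close> and \<open>q\<close>, then bending it there gives an
  admissible two-sided variation. Up to the factor \<open>(\<psi> q - \<psi> p) / (k - 1)!\<close> it lies between two
  truncated powers, so that the first variation identity, which holds for it exactly, turns into
  inequalities for these powers.\<close>

lemma truncated_power_sandwich:
  fixes x :: "nat \<Rightarrow> real"
  assumes k: "k \<ge> 2" and lse: "is_lse k n x g" and x: "\<And>i. i \<in> {1..n} \<Longrightarrow> x i > 0"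
    and \<psi>: "subgradient_on {0<..} (\<lambda>t. (-1) ^ (k - 2) * (deriv ^^ (k - 2)) g t) \<psi>"
    and pq: "0 < p" "p < q" and less: "\<psi> p < \<psi> q"
  defines "v \<equiv> \<lambda>a t. max (a - t) 0 ^ (k - 1)"
  shows "(LINT t|lambda_pos. g t * v p t) \<le> 1 / real n * (\<Sum>i = 1..n. v q (x i))"
    and "1 / real n * (\<Sum>i = 1..n. v p (x i)) \<le> (LINT t|lambda_pos. g t * v q t)"
proof -
  define N where "N = k - 2"
  have kN: "k = N + 2" "k - 1 = Suc N" using k by (auto simp: N_def)
  define F where "F = (\<lambda>l t. (-1) ^ l * (deriv ^^ l) g t)"
  have g: "g \<in> k_monotone k" "g \<in> square_integrable lambda_pos"
    using lse by (auto simp: is_lse_def is_arg_min_def)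
  have F: "descending_chain N F"
    using k_monotone_imp_descending_chain[OF g(1)] by (simp add: F_def N_def)
  have F0: "F 0 = g" by (simp add: F_def)
  have nonneg: "0 \<le> F l t" if "l \<le> N" "t > 0" for l t
    using g(1) that k by (auto simp: k_monotone_def F_def N_def)
  have anti: "antimono_on {0<..} (F N)"
    using g(1) k by (auto simp: k_monotone_def F_def N_def)
  have \<psi>': "subgradient_on {0<..} (F N) \<psi>"
    using \<psi> by (simp add: F_def N_def)
  let ?u = "bend (F N) \<psi> p q"
  have "continuous_on {0..} ?u"
    using continuous_on_bend[OF \<psi>' pq] by (rule continuous_on_subset) auto
  moreover have "?u t = 0" if "q \<le> t" for t
    using that pq by (auto simp: bend_def)
  ultimately obtain H where H: "descending_chain N H" "H N = ?u"
    "\<And>l. continuous_on {0..} (H l)" "\<And>l t. q \<le> t \<Longrightarrow> H l t = 0"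
    using descending_chain_exists[of ?u q N] pq by auto
  have H0: "H 0 \<in> square_integrable lambda_pos"
    by (rule square_integrable_continuous_bounded_support[OF H(3), where q = q])
       (use H(4) in auto)
  have "(\<lambda>t. g t + \<epsilon> * H 0 t) \<in> k_monotone k" if e: "\<bar>\<epsilon>\<bar> \<le> 1" for \<epsilon>
  proof -
    note top = add_bend_monotone[OF \<psi>' pq e _ anti]
    have "(\<lambda>t. F 0 t + \<epsilon> * H 0 t) \<in> k_monotone (N + 2)"
    proof (rule descending_chain_imp_k_monotone[OF descending_chain_add[OF F H(1)], where q = q])
      show "antimono_on {0<..} (\<lambda>t. F N t + \<epsilon> * H N t)"
        "convex_on {0<..} (\<lambda>t. F N t + \<epsilon> * H N t)"
        unfolding H(2) using top nonneg by auto
      show "0 \<le> F N t + \<epsilon> * H N t" if "0 < t" for t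
        unfolding H(2) using top nonneg that by auto
      show "0 \<le> F l t + \<epsilon> * H l t" if "l \<le> N" "0 < t" "q \<le> t" for l t
        using nonneg H(4) that by simp
    qed
    then show ?thesis by (simp add: F0 kN)
  qed
  from first_variation[OF lse H0 this]
  have var: "(LINT t|lambda_pos. g t * H 0 t) = 1 / real n * (\<Sum>i = 1..n. H 0 (x i))" .
  define \<mu> where "\<mu> = (\<psi> q - \<psi> p) / fact (Suc N)"
  have \<mu>: "\<mu> > 0" using less by (simp add: \<mu>_def)
  let ?V = "\<lambda>a l t. max (a - t) 0 ^ (Suc N - l) / fact (Suc N - l)"
  note V = descending_chain_truncated_power[of N]
  have lower: "\<mu> * v p t \<le> H 0 t" if "t > 0" for t
  proof -
    have "0 \<le> H 0 t + (- (\<psi> q - \<psi> p)) * ?V p 0 t"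
    proof (rule descending_chain_nonneg[OF descending_chain_add[OF H(1) V], where q = q])
      show "0 \<le> H N t + - (\<psi> q - \<psi> p) * ?V p N t" if "t > 0" for t
        using bend_bounds(1)[OF \<psi>' pq that] by (simp add: H(2) Suc_diff_le algebra_simps)
      show "0 \<le> H l t + - (\<psi> q - \<psi> p) * ?V p l t" if "l \<le> N" "0 < t" "q \<le> t" for l t
        using H(4) that pq by (simp add: Suc_diff_le max_def)
    qed (use that in auto)
    then show ?thesis by (simp add: v_def \<mu>_def kN field_simps del: fact_Suc)
  qed
  have upper: "H 0 t \<le> \<mu> * v q t" if "t > 0" for t
  proof -
    have "0 \<le> (\<psi> q - \<psi> p) * ?V q 0 t + (- 1) * H 0 t"
    proof (rule descending_chain_nonneg[where q = q and N = N and
          F = "\<lambda>l t. (\<psi> q - \<psi> p) * ?V q l t + (- 1) * H l t"])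
      have "descending_chain N (\<lambda>l t. (\<psi> q - \<psi> p) * ?V q l t)"
        using descending_chain_sum[of "{q}" N ?V "\<lambda>_. \<psi> q - \<psi> p"] V by simp
      then show "descending_chain N (\<lambda>l t. (\<psi> q - \<psi> p) * ?V q l t + (- 1) * H l t)"
        using H(1) by (rule descending_chain_add)
      show "0 \<le> (\<psi> q - \<psi> p) * ?V q N t + (- 1) * H N t" if "t > 0" for t
        using bend_bounds(2)[OF \<psi>' pq that] by (simp add: H(2) Suc_diff_le algebra_simps)
      show "0 \<le> (\<psi> q - \<psi> p) * ?V q l t + (- 1) * H l t" if "l \<le> N" "0 < t" "q \<le> t" for l t
        using H(4) that pq by (simp add: Suc_diff_le max_def)
    qed (use that in auto)
    then show ?thesis by (simp add: v_def \<mu>_def kN field_simps del: fact_Suc)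
  qed
  have v_int: "integrable lambda_pos (\<lambda>t. g t * v a t)" for a
  proof (rule square_integrable_mult[OF g(2)], rule square_integrable_continuous_bounded_support)
    show "continuous_on {0..} (v a)" unfolding v_def by (intro continuous_intros)
    show "v a t = 0" if "a < t" for t using that k by (simp add: v_def max_def)
  qed
  note H_int = square_integrable_mult[OF g(2) H0]
  have sum_mono: "1 / real n * (\<Sum>i = 1..n. a (x i)) \<le> 1 / real n * (\<Sum>i = 1..n. b (x i))"
    if "\<And>t. t > 0 \<Longrightarrow> a t \<le> b t" for a b
    using that x by (intro mult_left_mono sum_mono) auto
  have pull: "1 / real n * (\<Sum>i = 1..n. \<mu> * v a (x i)) = \<mu> * (1 / real n * (\<Sum>i = 1..n. v a (x i)))"
    "(LINT t|lambda_pos. g t * (\<mu> * v a t)) = \<mu> * (LINT t|lambda_pos. g t * v a t)" for a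
    using integral_mult_right_zero[of lambda_pos \<mu> "\<lambda>t. g t * v a t"]
    by (simp_all add: sum_distrib_left mult.left_commute)
  have pull_int: "integrable lambda_pos (\<lambda>t. g t * (\<mu> * v a t))" for a
    using integrable_mult_right[OF v_int[of a], of \<mu>] by (simp add: mult.left_commute)
  have g_nonneg: "0 \<le> g t" if "t > 0" for t
    using nonneg[of 0 t] that F0 by simp
  have "\<mu> * (LINT t|lambda_pos. g t * v p t) \<le> (LINT t|lambda_pos. g t * H 0 t)"
    unfolding pull(2)[symmetric]
    by (rule integral_mono[OF pull_int H_int]) (auto intro!: mult_left_mono lower g_nonneg)
  also have "\<dots> \<le> \<mu> * (1 / real n * (\<Sum>i = 1..n. v q (x i)))"
    unfolding var pull(1)[symmetric] by (rule sum_mono[of "H 0" "\<lambda>t. \<mu> * v q t"]) (rule upper)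
  finally show "(LINT t|lambda_pos. g t * v p t) \<le> 1 / real n * (\<Sum>i = 1..n. v q (x i))"
    using \<mu> mult_le_cancel_left_pos by blast
  have "\<mu> * (1 / real n * (\<Sum>i = 1..n. v p (x i))) \<le> (LINT t|lambda_pos. g t * H 0 t)"
    unfolding var pull(1)[symmetric] by (rule sum_mono[of "\<lambda>t. \<mu> * v p t" "H 0"]) (rule lower)
  also have "\<dots> \<le> \<mu> * (LINT t|lambda_pos. g t * v q t)"
    unfolding pull(2)[symmetric]
    by (rule integral_mono[OF H_int pull_int]) (auto intro!: mult_left_mono upper g_nonneg)
  finally show "1 / real n * (\<Sum>i = 1..n. v p (x i)) \<le> (LINT t|lambda_pos. g t * v q t)"
    using \<mu> mult_le_cancel_left_pos by blast
qed

section \<open>Integrals against truncated powers\<close>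

definition moment :: "(real \<Rightarrow> real) \<Rightarrow> nat \<Rightarrow> real \<Rightarrow> real" where
  "moment w j s = integral {0..s} (\<lambda>x. w x * (s - x) ^ j)"

lemma power_diff_integrable:
  fixes w :: "real \<Rightarrow> real"
  assumes "\<And>m. (\<lambda>x. w x * x ^ m) integrable_on S"
  shows "(\<lambda>x. w x * (s - x) ^ j) integrable_on S"
  using assms
proof (induction j arbitrary: w)
  case 0
  then show ?case using "0"[of 0] by simp
next
  case (Suc j)
  have "(\<lambda>x. s * (w x * (s - x) ^ j) - (w x * x) * (s - x) ^ j) integrable_on S"
  proof (intro integrable_diff integrable_on_mult_right Suc.IH)
    show "(\<lambda>x. w x * x * x ^ m) integrable_on S" for m
      using Suc.prems[of "Suc m"] by (simp add: mult.assoc)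
  qed (rule Suc.prems)
  then show ?case by (simp add: algebra_simps)
qed

text \<open>Splitting off one factor \<open>s - x\<close> and absorbing \<open>x\<close> into the weight turns the dependence of
  the integrand on the upper limit into products, so that the product rule replaces a theorem on
  differentiation under the integral. The weight may be unbounded at \<open>0\<close>.\<close>

lemma moment_Suc:
  assumes "\<And>m b. (\<lambda>x. w x * x ^ m) integrable_on {0..b}"
  shows "moment w (Suc j) s = s * moment w j s - moment (\<lambda>x. w x * x) j s"
proof -
  have 1: "(\<lambda>x. w x * (s - x) ^ j) integrable_on {0..s}"
    using assms by (rule power_diff_integrable)
  have 2: "(\<lambda>x. w x * x * (s - x) ^ j) integrable_on {0..s}"
  proof (rule power_diff_integrable)
    show "(\<lambda>x. w x * x * x ^ m) integrable_on {0..s}" for m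
      using assms[of "Suc m" s] by (simp add: mult.assoc)
  qed
  have "moment w (Suc j) s = integral {0..s} (\<lambda>x. s * (w x * (s - x) ^ j) - w x * x * (s - x) ^ j)"
    by (simp add: moment_def algebra_simps)
  also have "\<dots> = s * moment w j s - moment (\<lambda>x. w x * x) j s"
    using 1 2 by (subst integral_diff) (auto simp: moment_def intro!: integrable_on_mult_right)
  finally show ?thesis .
qed

lemma moment_0_has_derivative:
  assumes "\<And>b. w integrable_on {0..b}" "isCont w s" "s > 0"
  shows "(moment w 0 has_real_derivative w s) (at s)"
proof -
  have "((\<lambda>u. integral {0..u} w) has_vector_derivative w s) (at s within ({0..s + 1} - {}))"
    using assms by (intro integral_has_vector_derivative_continuous_at)
      (auto intro: continuous_at_imp_continuous_at_within)
  then have "((\<lambda>u. integral {0..u} w) has_real_derivative w s) (at s)"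
    using assms(3) at_within_Icc_at[of 0 s "s + 1"]
    by (simp add: has_real_derivative_iff_has_vector_derivative)
  then show ?thesis by (simp add: moment_def[abs_def])
qed

lemma moment_Suc_has_derivative:
  assumes "\<And>m b. (\<lambda>x. w x * x ^ m) integrable_on {0..b}" "isCont w s" "s > 0"
  shows "(moment w (Suc j) has_real_derivative real (Suc j) * moment w j s) (at s)"
  using assms(1,2)
proof (induction j arbitrary: w)
  case (0 w)
  have wx: "(\<lambda>x. w x * x * x ^ m) integrable_on {0..b}" for m b
    using "0.prems"(1)[of "Suc m" b] by (simp add: mult.assoc)
  have d: "(moment w 0 has_real_derivative w s) (at s)"
    by (rule moment_0_has_derivative) (use "0.prems"(1)[of 0] "0.prems"(2) assms(3) in auto)
  have d': "(moment (\<lambda>x. w x * x) 0 has_real_derivative w s * s) (at s)"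
    by (rule moment_0_has_derivative)
       (use wx[of 0] "0.prems"(2) assms(3) in \<open>auto intro!: continuous_intros\<close>)
  have "((\<lambda>s. s * moment w 0 s - moment (\<lambda>x. w x * x) 0 s) has_real_derivative
      (1 * moment w 0 s + w s * s) - w s * s) (at s)"
    by (intro DERIV_diff DERIV_mult' DERIV_ident d d' DERIV_cong[OF DERIV_mult[OF DERIV_ident d]]) auto
  then show ?case
    using moment_Suc[OF "0.prems"(1)] by simp
next
  case (Suc j)
  have wx: "(\<lambda>x. w x * x * x ^ m) integrable_on {0..b}" for m b
    using Suc.prems(1)[of "Suc m" b] by (simp add: mult.assoc)
  have d: "(moment w (Suc j) has_real_derivative real (Suc j) * moment w j s) (at s)"
    by (rule Suc.IH) (use Suc.prems in auto)
  have d': "(moment (\<lambda>x. w x * x) (Suc j) has_real_derivative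
      real (Suc j) * moment (\<lambda>x. w x * x) j s) (at s)"
    by (rule Suc.IH) (use Suc.prems wx in \<open>auto intro!: continuous_intros\<close>)
  have "((\<lambda>s. s * moment w (Suc j) s - moment (\<lambda>x. w x * x) (Suc j) s) has_real_derivative
      (1 * moment w (Suc j) s + real (Suc j) * moment w j s * s)
        - real (Suc j) * moment (\<lambda>x. w x * x) j s) (at s)"
    by (intro DERIV_diff DERIV_mult DERIV_ident d d')
  moreover have "(1 * moment w (Suc j) s + real (Suc j) * moment w j s * s)
        - real (Suc j) * moment (\<lambda>x. w x * x) j s = real (Suc (Suc j)) * moment w (Suc j) s"
    by (simp add: moment_Suc[OF Suc.prems(1), of j s] algebra_simps)
  ultimately show ?case
    by (simp add: moment_Suc[OF Suc.prems(1), abs_def])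
qed

lemma square_integrable_power_integrable:
  assumes "g \<in> square_integrable lambda_pos"
  shows "set_integrable lborel {0..b} (\<lambda>x. indicator {0<..} x * g x * x ^ m)"
proof -
  have "(\<lambda>x. indicator {0..b} x * x ^ m) \<in> square_integrable lambda_pos"
  proof (rule square_integrable_bounded_support)
    show "(\<lambda>x. indicator {0..b} x * x ^ m) \<in> borel_measurable lambda_pos"
      unfolding lambda_pos_def by (rule measurable_restrict_space1) measurable
    show "\<bar>indicator {0..b} x * x ^ m\<bar> \<le> b ^ m" if "0 < x" "x \<le> b" for x
      using that by (auto intro: power_mono)
  qed auto
  from square_integrable_mult[OF assms this]
  show ?thesis
    by (simp add: integrable_lambda_pos_iff set_integrable_def mult_ac)
qed

lemma integral_truncated_power_eq_moment:
  assumes "g \<in> square_integrable lambda_pos"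
  shows "(LINT t|lambda_pos. g t * max (s - t) 0 ^ Suc j)
           = moment (\<lambda>x. indicator {0<..} x * g x) (Suc j) s"
proof -
  let ?W = "\<lambda>x. indicator {0<..} x * g x"
  have "set_integrable lborel {0..s} (\<lambda>x. ?W x * (s - x) ^ Suc j)"
  proof -
    have "(\<lambda>x. max (s - x) 0 ^ Suc j) \<in> square_integrable lambda_pos"
      by (rule square_integrable_continuous_bounded_support[where q = s])
         (auto intro!: continuous_intros simp del: power_Suc)
    from square_integrable_mult[OF assms this]
    have "integrable lborel (\<lambda>x. indicator {0<..} x * (g x * max (s - x) 0 ^ Suc j))"
      by (simp add: integrable_lambda_pos_iff del: power_Suc)
    also have "(\<lambda>x. indicator {0<..} x * (g x * max (s - x) 0 ^ Suc j))
        = (\<lambda>x. indicator {0..s} x *\<^sub>R (?W x * (s - x) ^ Suc j))"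
      by (auto simp: fun_eq_iff indicator_def max_def)
    finally show ?thesis by (simp add: set_integrable_def del: power_Suc)
  qed
  then have "moment ?W (Suc j) s = (LINT x:{0..s}|lborel. ?W x * (s - x) ^ Suc j)"
    unfolding moment_def by (rule set_borel_integral_eq_integral(2)[symmetric])
  also have "\<dots> = (LINT t|lambda_pos. g t * max (s - t) 0 ^ Suc j)"
    unfolding lebesgue_integral_lambda_pos set_lebesgue_integral_def
    by (rule Bochner_Integration.integral_cong) (auto simp: indicator_def max_def)
  finally show ?thesis by simp
qed

section \<open>Kinks of the top function\<close>

definition kinks :: "(real \<Rightarrow> real) \<Rightarrow> real set" where
  "kinks f = {s. s > 0 \<and> \<not> (\<exists>\<alpha> \<beta>. \<forall>\<^sub>F x in nhds s. f x = \<alpha> + \<beta> * x)}"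

text \<open>Equal subgradients at \<open>p\<close> and \<open>q\<close> would make \<open>\<psi>\<close> constant in between, hence \<open>f\<close> affine near \<open>s\<close>.\<close>

lemma subgradient_increases_at_kink:
  assumes f: "subgradient_on {0<..} f \<psi>" and s: "s \<in> kinks f" and pq: "0 < p" "p < s" "s < q"
  shows "\<psi> p < \<psi> q"
proof (rule ccontr)
  assume "\<not> \<psi> p < \<psi> q"
  then have const: "\<psi> x = \<psi> p" if "x \<in> {p<..<q}" for x
    using subgradient_on_mono[OF f, of p x] subgradient_on_mono[OF f, of x q] that pq by auto
  have "f x = (f p - \<psi> p * p) + \<psi> p * x" if "x \<in> {p<..<q}" for x
    using subgradient_onD[OF f, of p x] subgradient_onD[OF f, of x p] const[OF that] that pq
    by (auto simp: algebra_simps)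
  then have "\<forall>\<^sub>F x in nhds s. f x = (f p - \<psi> p * p) + \<psi> p * x"
    using pq by (intro eventually_nhds_in_open[of "{p<..<q}", THEN eventually_mono]) auto
  with s show False by (auto simp: kinks_def)
qed

lemma le_at_common_limit:
  fixes A B :: "real \<Rightarrow> real"
  assumes le: "\<And>p q. \<lbrakk>0 < p; p < s; s < q\<rbrakk> \<Longrightarrow> A p \<le> B q"
    and "s > 0" "isCont A s" "isCont B s"
  shows "A s \<le> B s"
proof -
  have "A s \<le> B q" if "s < q" for q
  proof (rule tendsto_upperbound)
    show "(A \<longlongrightarrow> A s) (at_left s)"
      using assms(3) by (auto simp: isCont_def intro: tendsto_within_subset)
    show "\<forall>\<^sub>F p in at_left s. A p \<le> B q"
      by (rule eventually_at_leftI[of 0]) (use le that \<open>s > 0\<close> in auto)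
  qed auto
  then have "\<forall>\<^sub>F q in at_right s. A s \<le> B q"
    by (intro eventually_at_rightI[of s "s + 1"]) auto
  moreover have "(B \<longlongrightarrow> B s) (at_right s)"
    using assms(4) by (auto simp: isCont_def intro: tendsto_within_subset)
  ultimately show ?thesis
    by (intro tendsto_lowerbound[of B "B s" "at_right s"]) auto
qed

lemma finite_zeros_by_Rolle:
  fixes f f' :: "real \<Rightarrow> real"
  assumes S: "\<And>a b x. \<lbrakk>a \<in> S; b \<in> S; a \<le> x; x \<le> b\<rbrakk> \<Longrightarrow> x \<in> S"
    and f: "\<And>x. x \<in> S \<Longrightarrow> (f has_real_derivative f' x) (at x)"
    and fin: "finite {x \<in> S. f' x = 0}"
  shows "finite {x \<in> S. f x = 0}"
proof -
  \<comment> \<open>The zeros of \<open>f'\<close> below a zero of \<open>f\<close> determine it.\<close>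
  let ?below = "\<lambda>z. {y \<in> S. f' y = 0 \<and> y < z}"
  have "?below a \<noteq> ?below b" if "a \<in> S" "f a = 0" "b \<in> S" "f b = 0" "a < b" for a b
  proof -
    have "\<exists>z. a < z \<and> z < b \<and> DERIV f z :> 0"
    proof (rule Rolle)
      have in_S: "x \<in> S" if "a \<le> x" "x \<le> b" for x
        using S that \<open>a \<in> S\<close> \<open>b \<in> S\<close> by blast
      show "continuous_on {a..b} f"
        by (rule DERIV_continuous_on) (use f in_S in \<open>auto intro: has_field_derivative_at_within\<close>)
      show "f differentiable (at x)" if "a < x" "x < b" for x
        using f[of x] in_S[of x] that by (auto simp: real_differentiable_def)
    qed (use that in auto)
    then obtain z where z: "a < z" "z < b" "DERIV f z :> 0" by blast
    moreover have "z \<in> S" using S that z by (meson less_imp_le)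
    ultimately have "z \<in> ?below b - ?below a"
      using DERIV_unique[OF f] by auto
    then show ?thesis by blast
  qed
  then have "inj_on ?below {x \<in> S. f x = 0}"
    by (intro inj_onI) (metis (mono_tags, lifting) linorder_neq_iff mem_Collect_eq)
  moreover have "?below ` {x \<in> S. f x = 0} \<subseteq> Pow {x \<in> S. f' x = 0}"
    by auto
  ultimately show ?thesis
    using fin by (meson finite_Pow_iff finite_imageD finite_subset)
qed

text \<open>Differentiating the expression \<open>j + 1\<close> times leaves \<open>j! w\<close>, which has no zero
  in \<open>S\<close>; Rolle's theorem climbs back. In the application \<open>A\<close> is \<open>{i. x i < s}\<close>, which depends on \<open>s\<close>
  but takes only finitely many values, so that \<open>A\<close> may be held fixed here.\<close>

lemma finite_moment_zeros:
  assumes int: "\<And>m b. (\<lambda>x. w x * x ^ m) integrable_on {0..b}"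
    and S: "\<And>a b x. \<lbrakk>a \<in> S; b \<in> S; a \<le> x; x \<le> b\<rbrakk> \<Longrightarrow> x \<in> S"
    and w: "\<And>s. s \<in> S \<Longrightarrow> s > 0 \<and> isCont w s \<and> w s \<noteq> 0"
  shows "finite {s \<in> S. moment w j s - c * (\<Sum>i\<in>A. (s - x i) ^ j) = 0}"
proof (induction j)
  case 0
  have "(moment w 0 has_real_derivative w s) (at s)" if "s \<in> S" for s
    by (rule moment_0_has_derivative) (use int[of 0] w that in auto)
  then have d: "((\<lambda>s. moment w 0 s - c * (\<Sum>i\<in>A. (s - x i) ^ 0)) has_real_derivative w s) (at s)"
    if "s \<in> S" for s
    using that by (auto intro!: derivative_eq_intros)
  have "{s \<in> S. w s = 0} = {}" using w by blast
  then have "finite {s \<in> S. w s = 0}" by (metis finite.emptyI)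
  with S d show ?case
    by (rule finite_zeros_by_Rolle)
next
  case (Suc j)
  have d: "((\<lambda>s. moment w (Suc j) s - c * (\<Sum>i\<in>A. (s - x i) ^ Suc j)) has_real_derivative
      real (Suc j) * (moment w j s - c * (\<Sum>i\<in>A. (s - x i) ^ j))) (at s)" if "s \<in> S" for s
  proof -
    have 1: "(moment w (Suc j) has_real_derivative real (Suc j) * moment w j s) (at s)"
      by (rule moment_Suc_has_derivative[OF int]) (use w that in auto)
    have 2: "((\<lambda>s. \<Sum>i\<in>A. (s - x i) ^ Suc j) has_real_derivative
        (\<Sum>i\<in>A. real (Suc j) * (s - x i) ^ j)) (at s)"
      by (auto intro!: derivative_eq_intros simp del: power_Suc)
    show ?thesis
      using DERIV_diff[OF 1 DERIV_cmult[OF 2, of c]]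
      by (simp add: sum_distrib_left algebra_simps)
  qed
  have "finite {s \<in> S. real (Suc j) * (moment w j s - c * (\<Sum>i\<in>A. (s - x i) ^ j)) = 0}"
    using Suc.IH by simp
  with S d show ?case
    by (rule finite_zeros_by_Rolle)
qed

text \<open>Letting \<open>p\<close> and \<open>q\<close> tend to a kink \<open>s\<close> in the two sandwich inequalities gives an identity between
  a moment of \<open>g\<close> and a sum over the sample points below \<open>s\<close>, and where \<open>g > 0\<close> such
  identities hold at finitely many points only.\<close>

lemma finite_kinks:
  fixes x :: "nat \<Rightarrow> real"
  assumes k: "k \<ge> 2" and lse: "is_lse k n x g" and x: "\<And>i. i \<in> {1..n} \<Longrightarrow> x i > 0"
  shows "finite (kinks (\<lambda>t. (-1) ^ (k - 2) * (deriv ^^ (k - 2)) g t))"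
proof -
  define N where "N = k - 2"
  define F where "F = (\<lambda>l t. (-1) ^ l * (deriv ^^ l) g t)"
  have kN: "k - 1 = Suc N" using k by (auto simp: N_def)
  have g: "g \<in> k_monotone k" "g \<in> square_integrable lambda_pos"
    using lse by (auto simp: is_lse_def is_arg_min_def)
  have F: "descending_chain N F"
    using k_monotone_imp_descending_chain[OF g(1)] by (simp add: F_def N_def)
  have F0: "F 0 = g" by (simp add: F_def)
  have conv: "convex_on {0<..} (F l)" if "l \<le> N" for l
    using g(1) that k by (auto simp: k_monotone_def F_def N_def)
  have nonneg: "0 \<le> g t" if "t > 0" for t
    using g(1) that k by (auto simp: k_monotone_def elim!: allE[of _ "0::nat"])
  have anti: "g t \<le> g s" if "0 < s" "s \<le> t" for s t
    using g(1) that k by (auto simp: k_monotone_def monotone_on_def elim!: allE[of _ "0::nat"])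
  have g_cont: "isCont g s" if "s > 0" for s
    using convex_on_continuous[OF open_greaterThan conv[of 0]] that
    by (simp add: F0 continuous_on_eq_continuous_at)
  define W where "W = (\<lambda>x. indicator {0<..} x * g x)"
  have W: "W s = g s \<and> isCont W s" if "s > 0" for s
  proof -
    have "\<forall>\<^sub>F t in nhds s. W t = g t"
      using eventually_nhds_in_open[of "{0<..}" s] that
      by (auto elim!: eventually_mono simp: W_def)
    then show ?thesis
      using g_cont[OF that] isCont_cong[of W g s] that by (simp add: W_def)
  qed
  have int: "(\<lambda>t. W t * t ^ m) integrable_on {0..b}" for m b
    using square_integrable_power_integrable[OF g(2)] unfolding W_def
    by (rule set_borel_integral_eq_integral(1))
  have mom: "(LINT t|lambda_pos. g t * max (s - t) 0 ^ Suc N) = moment W (Suc N) s" for s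
    unfolding W_def by (rule integral_truncated_power_eq_moment[OF g(2)])
  obtain \<psi> where \<psi>: "subgradient_on {0<..} (F N) \<psi>"
    using convex_on_subgradient_exists[OF conv[of N]] by blast
  have kink: "moment W (Suc N) s - 1 / real n * (\<Sum>i\<in>{i\<in>{1..n}. x i < s}. (s - x i) ^ Suc N) = 0"
    if s: "s \<in> kinks (F N)" for s
  proof -
    have s0: "s > 0" using s by (simp add: kinks_def)
    define B where "B = (\<lambda>a. 1 / real n * (\<Sum>i = 1..n. max (a - x i) 0 ^ Suc N))"
    have \<psi>': "subgradient_on {0<..} (\<lambda>t. (-1) ^ (k - 2) * (deriv ^^ (k - 2)) g t) \<psi>"
      using \<psi> unfolding F_def N_def .
    have le: "moment W (Suc N) p \<le> B q" "B p \<le> moment W (Suc N) q" if "0 < p" "p < s" "s < q" for p q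
    proof -
      have "p < q" using that by simp
      note sandwich = truncated_power_sandwich[OF k lse x \<psi>' \<open>0 < p\<close> this
          subgradient_increases_at_kink[OF \<psi> s that], unfolded kN mom]
      show "moment W (Suc N) p \<le> B q" unfolding B_def by (rule sandwich(1))
      show "B p \<le> moment W (Suc N) q" unfolding B_def by (rule sandwich(2))
    qed
    have "(moment W (Suc N) has_real_derivative real (Suc N) * moment W N s) (at s)"
      by (rule moment_Suc_has_derivative[OF int]) (use W s0 in auto)
    then have c1: "isCont (moment W (Suc N)) s"
      by (rule DERIV_isCont)
    have c2: "isCont B s"
      unfolding B_def by (intro continuous_intros)
    have "moment W (Suc N) s = B s"
      using le_at_common_limit[OF le(1) s0 c1 c2] le_at_common_limit[OF le(2) s0 c2 c1] by auto
    moreover have "(\<Sum>i = 1..n. max (s - x i) 0 ^ Suc N)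
        = (\<Sum>i\<in>{i\<in>{1..n}. x i < s}. (s - x i) ^ Suc N)"
      by (rule sum.mono_neutral_cong_right) (auto simp: max_def)
    ultimately show ?thesis by (simp add: B_def)
  qed
  define S where "S = {s. s > 0 \<and> g s > 0}"
  have S: "t \<in> S" if "a \<in> S" "b \<in> S" "a \<le> t" "t \<le> b" for a b t
    using that anti[of t b] by (auto simp: S_def)
  define Z where "Z = (\<lambda>A. {s \<in> S. moment W (Suc N) s - 1 / real n * (\<Sum>i\<in>A. (s - x i) ^ Suc N) = 0})"
  have "finite (Z A)" for A
    unfolding Z_def by (rule finite_moment_zeros[OF int S]) (use W in \<open>auto simp: S_def\<close>)
  then have "finite (\<Union>A\<in>Pow {1..n}. Z A)"
    by simp
  moreover have "finite {s \<in> kinks (F N). g s = 0}"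
  proof -
    \<comment> \<open>Beyond its first zero \<open>g\<close> vanishes, so only that zero can be a kink.\<close>
    have no_kink: "t \<notin> kinks (F N)" if s: "0 < s" "g s = 0" and "s < t" for s t
    proof -
      have z: "F l y = 0" if "l \<le> N" "y > s" for l y
        using that
      proof (induction l arbitrary: y)
        case 0
        then show ?case using anti[of s y] nonneg[of y] s by (simp add: F0)
      next
        case (Suc l)
        have "((\<lambda>_. 0) has_real_derivative - F (Suc l) y) (at y)"
          by (rule has_field_derivative_transform_within_open[where S = "{s<..}" and f = "F l"])
             (use Suc s descending_chainD[OF F, of l y] in auto)
        then show ?case using DERIV_unique[OF _ DERIV_const] by fastforce
      qed
      have "\<forall>\<^sub>F y in nhds t. F N y = 0 + 0 * y"
        using eventually_nhds_in_open[of "{s<..}" t] \<open>s < t\<close> z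
        by (auto elim!: eventually_mono)
      then show ?thesis unfolding kinks_def by blast
    qed
    have unique: "s = t" if "s \<in> {s \<in> kinks (F N). g s = 0}" "t \<in> {s \<in> kinks (F N). g s = 0}" for s t
      using that no_kink[of s t] no_kink[of t s]
      by (cases s t rule: linorder_cases) (auto simp: kinks_def)
    show ?thesis
    proof (cases "{s \<in> kinks (F N). g s = 0} = {}")
      case False
      then obtain t where "t \<in> {s \<in> kinks (F N). g s = 0}" by blast
      then have "{s \<in> kinks (F N). g s = 0} \<subseteq> {t}" using unique by blast
      then show ?thesis by (rule finite_subset) simp
    qed (metis finite.emptyI)
  qed
  moreover have "kinks (F N) \<subseteq> (\<Union>A\<in>Pow {1..n}. Z A) \<union> {s \<in> kinks (F N). g s = 0}"
  proof
    fix s assume s: "s \<in> kinks (F N)"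
    then have "s > 0" by (simp add: kinks_def)
    show "s \<in> (\<Union>A\<in>Pow {1..n}. Z A) \<union> {s \<in> kinks (F N). g s = 0}"
    proof (cases "g s = 0")
      case False
      then have "s \<in> Z {i\<in>{1..n}. x i < s}"
        using kink[OF s] nonneg[of s] \<open>s > 0\<close> by (auto simp: Z_def S_def)
      then show ?thesis by (intro UnI1 UN_I[of "{i\<in>{1..n}. x i < s}"]) auto
    qed (use s in auto)
  qed
  ultimately have "finite (kinks (F N))"
    using finite_subset[OF _ finite_UnI] by blast
  then show ?thesis by (simp add: F_def N_def)
qed

section \<open>From finitely many kinks to a spline\<close>

text \<open>The derivative of such a function exists and is locally constant, hence constant.\<close>

lemma locally_affine_imp_affine:
  fixes f :: "real \<Rightarrow> real"
  assumes S: "open S" "convex S"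
    and f: "\<And>s. s \<in> S \<Longrightarrow> \<exists>\<alpha> \<beta>. \<forall>\<^sub>F x in nhds s. f x = \<alpha> + \<beta> * x"
  shows "\<exists>\<alpha> \<beta>. \<forall>x\<in>S. f x = \<alpha> + \<beta> * x"
proof -
  have "(f has_real_derivative deriv f s) (at s) \<and> (deriv f has_real_derivative 0) (at s)"
    if "s \<in> S" for s
  proof -
    obtain \<alpha> \<beta> where "\<forall>\<^sub>F x in nhds s. f x = \<alpha> + \<beta> * x"
      using f[OF \<open>s \<in> S\<close>] by blast
    then obtain U where U: "open U" "s \<in> U" "\<And>x. x \<in> U \<Longrightarrow> f x = \<alpha> + \<beta> * x"
      by (auto simp: eventually_nhds)
    have d: "(f has_real_derivative \<beta>) (at x)" if "x \<in> U" for x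
    proof -
      have "((\<lambda>x. \<alpha> + \<beta> * x) has_real_derivative \<beta>) (at x)"
        by (auto intro!: derivative_eq_intros)
      then show ?thesis
        by (rule has_field_derivative_transform_within_open[OF _ U(1) that]) (use U in auto)
    qed
    then have "deriv f x = \<beta>" if "x \<in> U" for x
      using that by (auto intro: DERIV_imp_deriv)
    then have "(deriv f has_real_derivative 0) (at s)"
      by (intro has_field_derivative_transform_within_open[OF DERIV_const[of \<beta>] U(1,2)]) auto
    then show ?thesis using d[OF U(2)] DERIV_imp_deriv by blast
  qed
  note d = this
  obtain \<beta> where \<beta>: "\<And>x. x \<in> S \<Longrightarrow> deriv f x = \<beta>"
    using has_field_derivative_zero_constant[OF S(2), of "deriv f"] d
    by (meson has_field_derivative_at_within)
  have "((\<lambda>x. f x - \<beta> * x) has_real_derivative 0) (at x within S)" if "x \<in> S" for x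
  proof -
    have "((\<lambda>x. f x - \<beta> * x) has_real_derivative deriv f x - \<beta>) (at x)"
      using d[OF that] by (auto intro!: derivative_eq_intros)
    then show ?thesis
      using \<beta>[OF that] by (simp add: has_field_derivative_at_within)
  qed
  then obtain \<alpha> where "\<And>x. x \<in> S \<Longrightarrow> f x - \<beta> * x = \<alpha>"
    using has_field_derivative_zero_constant[OF S(2), of "\<lambda>x. f x - \<beta> * x"] by blast
  then have "f x = \<alpha> + \<beta> * x" if "x \<in> S" for x
    using that by (simp add: diff_eq_eq)
  then show ?thesis by blast
qed

lemma piecewise_linear_eq_sum_of_truncations:
  fixes f :: "real \<Rightarrow> real"
  assumes "finite K" "kinks f \<subseteq> K" "K \<subseteq> {0<..}" "continuous_on {0<..} f"
  shows "\<exists>c \<alpha> \<beta>. \<forall>x>0. f x = \<alpha> + \<beta> * x + (\<Sum>a\<in>K. c a * max (a - x) 0)"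
  using assms
proof (induction K arbitrary: f rule: finite_induct)
  case empty
  then show ?case
    using locally_affine_imp_affine[of "{0<..}" f] by (auto simp: kinks_def)
next
  case (insert a K)
  have a: "a > 0" using insert.prems by auto
  have "open (- (K \<union> {..0}))"
    using insert.hyps by (intro open_Compl closed_Un) (auto simp: finite_imp_closed)
  moreover have "a \<in> - (K \<union> {..0})"
    using a insert.hyps by auto
  ultimately obtain \<delta> where \<delta>: "\<delta> > 0" "ball a \<delta> \<subseteq> - (K \<union> {..0})"
    using open_contains_ball by blast
  then have near: "x > 0 \<and> x \<notin> K" if "a - \<delta> < x" "x < a + \<delta>" for x
  proof -
    have "x \<in> ball a \<delta>" using that by (auto simp: dist_real_def)
    then show ?thesis using \<delta>(2) by force
  qed
  have loc: "\<exists>\<alpha> \<beta>. \<forall>\<^sub>F x in nhds s. f x = \<alpha> + \<beta> * x" if "s > 0" "s \<notin> insert a K" for s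
    using that insert.prems(1) by (auto simp: kinks_def)
  obtain \<alpha>\<^sub>1 \<beta>\<^sub>1 where left: "\<And>x. x \<in> {a - \<delta><..<a} \<Longrightarrow> f x = \<alpha>\<^sub>1 + \<beta>\<^sub>1 * x"
    using locally_affine_imp_affine[of "{a - \<delta><..<a}" f] loc near by force
  obtain \<alpha>\<^sub>2 \<beta>\<^sub>2 where right: "\<And>x. x \<in> {a<..<a + \<delta>} \<Longrightarrow> f x = \<alpha>\<^sub>2 + \<beta>\<^sub>2 * x"
    using locally_affine_imp_affine[of "{a<..<a + \<delta>}" f] loc near by force
  have cont: "isCont f a"
    using insert.prems(3) a by (simp add: continuous_on_eq_continuous_at)
  have fa: "f a = \<alpha>\<^sub>1 + \<beta>\<^sub>1 * a"
  proof (rule tendsto_unique)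
    show "(f \<longlongrightarrow> f a) (at_left a)"
      using cont by (auto simp: isCont_def intro: tendsto_within_subset)
    have "((\<lambda>x. \<alpha>\<^sub>1 + \<beta>\<^sub>1 * x) \<longlongrightarrow> \<alpha>\<^sub>1 + \<beta>\<^sub>1 * a) (at_left a)"
      by (intro tendsto_intros)
    moreover have "\<forall>\<^sub>F x in at_left a. \<alpha>\<^sub>1 + \<beta>\<^sub>1 * x = f x"
      by (rule eventually_at_leftI[of "a - \<delta>"]) (use left \<delta> in auto)
    ultimately show "(f \<longlongrightarrow> \<alpha>\<^sub>1 + \<beta>\<^sub>1 * a) (at_left a)"
      by (rule Lim_transform_eventually)
  qed auto
  have fa': "f a = \<alpha>\<^sub>2 + \<beta>\<^sub>2 * a"
  proof (rule tendsto_unique)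
    show "(f \<longlongrightarrow> f a) (at_right a)"
      using cont by (auto simp: isCont_def intro: tendsto_within_subset)
    have "((\<lambda>x. \<alpha>\<^sub>2 + \<beta>\<^sub>2 * x) \<longlongrightarrow> \<alpha>\<^sub>2 + \<beta>\<^sub>2 * a) (at_right a)"
      by (intro tendsto_intros)
    moreover have "\<forall>\<^sub>F x in at_right a. \<alpha>\<^sub>2 + \<beta>\<^sub>2 * x = f x"
      by (rule eventually_at_rightI[of _ "a + \<delta>"]) (use right \<delta> in auto)
    ultimately show "(f \<longlongrightarrow> \<alpha>\<^sub>2 + \<beta>\<^sub>2 * a) (at_right a)"
      by (rule Lim_transform_eventually)
  qed auto
  \<comment> \<open>Subtracting the jump of the slope at \<open>a\<close> removes the kink there and creates no other.\<close>
  define c\<^sub>0 where "c\<^sub>0 = \<beta>\<^sub>2 - \<beta>\<^sub>1"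
  define h where "h = (\<lambda>x. f x - c\<^sub>0 * max (a - x) 0)"
  have "h x = \<alpha>\<^sub>2 + \<beta>\<^sub>2 * x" if "x \<in> {a - \<delta><..<a + \<delta>}" for x
    using left[of x] right[of x] fa fa' that
    by (cases x a rule: linorder_cases) (auto simp: h_def c\<^sub>0_def algebra_simps)
  then have "\<forall>\<^sub>F x in nhds a. h x = \<alpha>\<^sub>2 + \<beta>\<^sub>2 * x"
    using eventually_nhds_in_open[of "{a - \<delta><..<a + \<delta>}" a] \<delta> by (auto elim!: eventually_mono)
  then have "a \<notin> kinks h" by (auto simp: kinks_def)
  moreover have "s \<notin> kinks h" if s: "s \<notin> kinks f" "s \<noteq> a" for s
  proof (cases "s > 0")
    case True
    then obtain \<alpha> \<beta> where ev: "\<forall>\<^sub>F x in nhds s. f x = \<alpha> + \<beta> * x"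
      using s by (auto simp: kinks_def)
    show ?thesis
    proof (cases "s < a")
      case True
      then have "\<forall>\<^sub>F x in nhds s. x < a"
        using eventually_nhds_in_open[of "{..<a}" s] by auto
      with ev have "\<forall>\<^sub>F x in nhds s. h x = (\<alpha> - c\<^sub>0 * a) + (\<beta> + c\<^sub>0) * x"
        by eventually_elim (auto simp: h_def algebra_simps)
      then show ?thesis by (auto simp: kinks_def)
    next
      case False
      then have "\<forall>\<^sub>F x in nhds s. a < x"
        using eventually_nhds_in_open[of "{a<..}" s] s by auto
      with ev have "\<forall>\<^sub>F x in nhds s. h x = \<alpha> + \<beta> * x"
        by eventually_elim (auto simp: h_def)
      then show ?thesis by (auto simp: kinks_def)
    qed
  qed (auto simp: kinks_def)
  ultimately have "s \<in> K" if "s \<in> kinks h" for s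
    using insert.prems(1) that by (cases "s = a") auto
  then have "kinks h \<subseteq> K" by (rule subsetI)
  moreover have "continuous_on {0<..} h"
    unfolding h_def using insert.prems(3) by (intro continuous_intros)
  ultimately obtain c \<alpha> \<beta> where c:
    "\<And>x. x > 0 \<Longrightarrow> h x = \<alpha> + \<beta> * x + (\<Sum>b\<in>K. c b * max (b - x) 0)"
    using insert.IH[of h] insert.prems(2) by (metis insert_subset)
  have "f x = \<alpha> + \<beta> * x + (\<Sum>b\<in>insert a K. (c(a := c\<^sub>0)) b * max (b - x) 0)" if "x > 0" for x
  proof -
    have "(\<Sum>b\<in>K. (c(a := c\<^sub>0)) b * max (b - x) 0) = (\<Sum>b\<in>K. c b * max (b - x) 0)"
      by (rule sum.cong) (use insert.hyps in auto)
    then show ?thesis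
      using c[OF that] insert.hyps by (simp add: h_def algebra_simps)
  qed
  then show ?case by blast
qed

lemma square_integrable_antimono_tendsto_0:
  assumes g: "g \<in> square_integrable lambda_pos" and anti: "antimono_on {0<..} g"
    and nonneg: "\<And>t. t > 0 \<Longrightarrow> 0 \<le> g t"
  shows "(g \<longlongrightarrow> 0) at_top"
proof (rule order_tendstoI)
  fix e :: real assume "0 < e"
  have "\<exists>t>0. g t < e"
  proof (rule ccontr)
    assume "\<not> ?thesis"
    then have ge: "e \<le> g t" if "t > 0" for t using that by force
    have "integrable lambda_pos (\<lambda>t. (g t)\<^sup>2)"
      using g by (simp add: square_integrable_def)
    then have "integrable lambda_pos (\<lambda>t. e\<^sup>2)"
      by (rule Bochner_Integration.integrable_bound) (use ge \<open>0 < e\<close> in \<open>auto intro!: AE_I2 power_mono\<close>)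
    then have "integrable lborel (\<lambda>t::real. e\<^sup>2 * indicator {0<..} t)"
      by (simp add: integrable_lambda_pos_iff mult.commute)
    then have "integrable lborel (indicator {0<..} :: real \<Rightarrow> real)"
      using \<open>0 < e\<close> by simp
    then have fin: "emeasure lborel {0::real<..} < \<infinity>"
      by (simp add: integrable_indicator_iff)
    have m: "of_nat m \<le> emeasure lborel {0::real<..}" for m :: nat
    proof -
      have "of_nat m = emeasure lborel {0<..real m}"
        by (simp add: ennreal_of_nat_eq_real_of_nat)
      also have "\<dots> \<le> emeasure lborel {0::real<..}"
        by (rule emeasure_mono) auto
      finally show ?thesis .
    qed
    obtain m :: nat where "emeasure lborel {0::real<..} < of_nat m"
      using fin ennreal_Ex_less_of_nat by (metis infinity_ennreal_def)
    with m[of m] show False by simp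
  qed
  then obtain T where T: "T > 0" "g T < e" by blast
  show "\<forall>\<^sub>F t in at_top. g t < e"
    using eventually_ge_at_top[of T]
  proof eventually_elim
    case (elim t)
    then have "g t \<le> g T" using anti T by (auto simp: monotone_on_def)
    then show ?case using T by simp
  qed
next
  fix e :: real assume "e < 0"
  then show "\<forall>\<^sub>F t in at_top. e < g t"
    by (intro eventually_mono[OF eventually_gt_at_top[of 0]]) (use nonneg \<open>e < 0\<close> in force)
qed

text \<open>Subtracting from the whole chain of \<open>g\<close> the chains of the truncated powers found in its top
  function leaves a chain with affine top. All its members tend to \<open>0\<close>, so the top is \<open>0\<close> and the
  chain collapses.\<close>

lemma lse_eq_finite_spline:
  fixes x :: "nat \<Rightarrow> real"
  assumes k: "k \<ge> 2" and lse: "is_lse k n x g" and x: "\<And>i. i \<in> {1..n} \<Longrightarrow> x i > 0"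
  obtains K c where "finite K" "K \<subseteq> {0<..}"
    "\<And>t. t > 0 \<Longrightarrow> g t = (\<Sum>a\<in>K. c a * max (a - t) 0 ^ (k - 1))"
proof -
  define N where "N = k - 2"
  define F where "F = (\<lambda>l t. (-1) ^ l * (deriv ^^ l) g t)"
  have kN: "k - 1 = Suc N" using k by (auto simp: N_def)
  have g: "g \<in> k_monotone k" "g \<in> square_integrable lambda_pos"
    using lse by (auto simp: is_lse_def is_arg_min_def)
  have F: "descending_chain N F"
    using k_monotone_imp_descending_chain[OF g(1)] by (simp add: F_def N_def)
  have F0: "F 0 = g" by (simp add: F_def)
  have conv: "convex_on {0<..} (F l)" and anti: "antimono_on {0<..} (F l)" if "l \<le> N" for l
    using g(1) that k by (auto simp: k_monotone_def F_def N_def)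
  have nonneg: "0 \<le> F l t" if "l \<le> N" "t > 0" for l t
    using g(1) that k by (auto simp: k_monotone_def F_def N_def)
  define K where "K = kinks (F N)"
  have K: "finite K" "K \<subseteq> {0<..}"
    using finite_kinks[OF k lse x] by (auto simp: K_def F_def N_def kinks_def)
  have "continuous_on {0<..} (F N)"
    by (rule convex_on_continuous[OF open_greaterThan conv]) simp
  then obtain c \<alpha> \<beta> where c: "\<And>t. t > 0 \<Longrightarrow> F N t = \<alpha> + \<beta> * t + (\<Sum>a\<in>K. c a * max (a - t) 0)"
    using piecewise_linear_eq_sum_of_truncations[OF K(1) _ K(2), of "F N"] by (auto simp: K_def)
  let ?V = "\<lambda>a l t. max (a - t) 0 ^ (Suc N - l) / fact (Suc N - l)"
  define E where "E = (\<lambda>l t. F l t + (- 1) * (\<Sum>a\<in>K. c a * ?V a l t))"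
  have E: "descending_chain N E"
    unfolding E_def
    by (intro descending_chain_add[OF F] descending_chain_sum descending_chain_truncated_power)
  have "(F 0 \<longlongrightarrow> 0) at_top"
    unfolding F0 using square_integrable_antimono_tendsto_0[OF g(2)] anti[of 0] nonneg[of 0]
    by (simp add: F0)
  then have F_lim: "(F l \<longlongrightarrow> 0) at_top" if "l \<le> N" for l
    using descending_chain_tendsto_0[OF F nonneg anti] that by blast
  have V_lim: "((\<lambda>t. ?V a l t) \<longlongrightarrow> 0) at_top" if "l \<le> N" for a :: real and l
  proof (rule tendsto_eventually)
    show "\<forall>\<^sub>F t in at_top. ?V a l t = 0"
      using eventually_ge_at_top[of a] by eventually_elim (use that in \<open>simp add: Suc_diff_le\<close>)
  qed
  have E_lim: "(E l \<longlongrightarrow> 0) at_top" if "l \<le> N" for l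
  proof -
    have "((\<lambda>t. F l t + (- 1) * (\<Sum>a\<in>K. c a * ?V a l t)) \<longlongrightarrow> 0 + (- 1) * (\<Sum>a\<in>K. c a * 0)) at_top"
      using that by (intro tendsto_intros F_lim V_lim)
    then show ?thesis by (simp add: E_def)
  qed
  have E_top: "E N t = \<alpha> + \<beta> * t" if "t > 0" for t
    using c[OF that] by (simp add: E_def Suc_diff_le)
  have lim: "((\<lambda>t. \<alpha> + \<beta> * t) \<longlongrightarrow> 0) at_top"
  proof (rule Lim_transform_eventually[OF E_lim])
    show "\<forall>\<^sub>F t in at_top. E N t = \<alpha> + \<beta> * t"
      using eventually_gt_at_top[of 0] by eventually_elim (rule E_top)
  qed simp
  have "\<beta> = 0"
  proof -
    have "filterlim (\<lambda>t::real. t + 1) at_top at_top"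
      using filterlim_tendsto_add_at_top[OF tendsto_const[of "1::real"] filterlim_ident]
      by (simp add: add.commute)
    from tendsto_diff[OF filterlim_compose[OF lim this] lim]
    have "((\<lambda>t::real. \<beta>) \<longlongrightarrow> 0) at_top"
      by (simp add: algebra_simps)
    then show ?thesis by (simp add: tendsto_const_iff)
  qed
  moreover from this lim have "\<alpha> = 0"
    by (simp add: tendsto_const_iff)
  ultimately have "E N t = 0" if "t > 0" for t
    using E_top[OF that] by simp
  then have "E 0 t = 0" if "t > 0" for t
    using descending_chain_eq_0[OF E _ E_lim, of 0 t] that by auto
  then have "g t = (\<Sum>a\<in>K. (c a / fact (k - 1)) * max (a - t) 0 ^ (k - 1))" if "t > 0" for t
    using \<open>\<And>t. t > 0 \<Longrightarrow> E 0 t = 0\<close>[OF that] unfolding kN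
    by (simp add: E_def F0 del: fact_Suc power_Suc)
  then show thesis
    by (rule that[OF K])
qed

theorem proposition2p3:
  fixes k n :: nat
    and M :: "'w measure"
    and X :: "nat \<Rightarrow> 'w \<Rightarrow> real"
    and g0 :: "real \<Rightarrow> real"
    and g_lse :: "'w \<Rightarrow> real \<Rightarrow> real"
  assumes "k \<ge> 2" and "n \<ge> 1"
    and "prob_space M"
    and "g0 \<in> k_monotone k"
    and "prob_space.indep_vars M (\<lambda>_. lambda_pos) X {1..n}"
    and "\<And>i. i \<in> {1..n} \<Longrightarrow> distributed M lambda_pos (X i) (\<lambda>x. ennreal (g0 x))"
    and "\<And>\<omega>. \<omega> \<in> space M \<Longrightarrow> is_lse k n (\<lambda>i. X i \<omega>) (g_lse \<omega>)"
  shows "\<forall>\<omega>\<in>space M. \<exists>(m::nat) (a::nat \<Rightarrow> real) (w::nat \<Rightarrow> real).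
           m \<noteq> 0 \<and> (\<forall>j\<in>{1..m}. a j > 0) \<and>
           (\<forall>x>0. g_lse \<omega> x =
              (\<Sum>j = 1..m. w j * (real k * (max (a j - x) 0) ^ (k - 1) / a j ^ k)))"
proof
  fix \<omega> assume \<omega>: "\<omega> \<in> space M"
  have "X i \<omega> > 0" if "i \<in> {1..n}" for i
  proof -
    have "X i \<in> measurable M lambda_pos"
      using assms(6)[OF that] by (rule distributed_measurable)
    from measurable_space[OF this \<omega>] show ?thesis by simp
  qed
  then obtain K c where K: "finite K" "K \<subseteq> {0<..}"
    and g: "\<And>t. t > 0 \<Longrightarrow> g_lse \<omega> t = (\<Sum>a\<in>K. c a * max (a - t) 0 ^ (k - 1))"
    using lse_eq_finite_spline[OF assms(1) assms(7)[OF \<omega>]] by blast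
  \<comment> \<open>A point of weight \<open>0\<close> makes the index range nonempty whatever \<open>K\<close> is.\<close>
  define K' where "K' = insert 1 K"
  define c' where "c' = (\<lambda>a. if a \<in> K then c a else 0)"
  have K': "finite K'" "K' \<subseteq> {0<..}" "K' \<noteq> {}"
    using K by (auto simp: K'_def)
  have g': "g_lse \<omega> t = (\<Sum>a\<in>K'. c' a * max (a - t) 0 ^ (k - 1))" if "t > 0" for t
    unfolding g[OF that] using K(1)
    by (intro sum.mono_neutral_cong_left) (auto simp: K'_def c'_def)
  obtain a where a: "bij_betw a {1..card K'} K'"
    using ex_bij_betw_nat_finite_1[OF K'(1)] by blast
  have pos: "a j > 0" if "j \<in> {1..card K'}" for j
    using bij_betwE[OF a] that K'(2) by blast
  have "g_lse \<omega> t = (\<Sum>j = 1..card K'. (c' (a j) * a j ^ k / real k)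
      * (real k * max (a j - t) 0 ^ (k - 1) / a j ^ k))" if "t > 0" for t
    unfolding g'[OF that] sum.reindex_bij_betw[OF a, symmetric]
  proof (rule sum.cong)
    fix j assume "j \<in> {1..card K'}"
    then have "a j \<noteq> 0" using pos[of j] by simp
    then show "c' (a j) * max (a j - t) 0 ^ (k - 1) = (c' (a j) * a j ^ k / real k)
        * (real k * max (a j - t) 0 ^ (k - 1) / a j ^ k)"
      using assms(1) by simp
  qed simp
  then show "\<exists>(m::nat) (a::nat \<Rightarrow> real) (w::nat \<Rightarrow> real).
           m \<noteq> 0 \<and> (\<forall>j\<in>{1..m}. a j > 0) \<and>
           (\<forall>x>0. g_lse \<omega> x =
              (\<Sum>j = 1..m. w j * (real k * (max (a j - x) 0) ^ (k - 1) / a j ^ k)))"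
    using pos K'(1,3) by (intro exI[of _ "card K'"] exI[of _ a]
        exI[of _ "\<lambda>j. c' (a j) * a j ^ k / real k"] conjI ballI allI impI) simp_all
qed

end
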